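(* Let $q=2^h$ and let $\mathrm{Tr}$ be the absolute trace function $\mathbb{F}_q\to\mathbb{F}_2$. Choose $\alpha,\beta\in\mathbb{F}_q\setminus\{0,1\}$ with $\alpha\beta\neq 1$, put $\gamma=\frac{\beta+1}{\alpha\beta+1}$ and $\xi=\alpha\beta\gamma$, and choose $a,b\in\mathbb{F}_2$. Define $S_0=\{(z,1,0): \mathrm{Tr}(z)=0,\ \mathrm{Tr}(z/\alpha)=a\}$, $S_1=\{(z,0,1): \mathrm{Tr}(z)=0,\ \mathrm{Tr}(z/(\alpha\gamma))=0\}$, $S_2=\{(z,1,1): \mathrm{Tr}(z)=1,\ \mathrm{Tr}(z/(\alpha\beta))=b\}$, $S_3=\{(z,\gamma,1): \mathrm{Tr}(z/(\alpha\gamma))=a+1,\ \mathrm{Tr}(z/\xi)=b+1\}$, $S_4=\{(z,\beta+1,1): \mathrm{Tr}(z/(\alpha\beta))=a+b+1,\ \mathrm{Tr}(z/\xi)=b\}$, where $z$ ranges over $\mathbb{F}_q$. Then $\mathcal{A}=\bigcup_{i=0}^4 S_i$ is a KM-arc of type $q/4$ in $\mathrm{PG}(2,q)$, and $\mathcal{A}$ has property (I) or property (II) with respect to the line $Z=0$.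
   Context: Points of $\mathrm{PG}(2,q)$ have homogeneous coordinates $(X,Y,Z)$. A KM-arc of type $t$ in $\mathrm{PG}(2,q)$ is a set of $q+t$ points such that every line meets it in $0$, $2$ or $t$ points, each value occurring. A KM-arc of type $q/4$ has five $q/4$-secants, concurrent in its nucleus $N$. An $\mathbb{F}_2$-linear set of rank $k$ on a line (viewed as $\mathrm{PG}(1,q)$) is the set of points defined by the nonzero vectors of a $k$-dimensional $\mathbb{F}_2$-subspace $W$ of $\mathbb{F}_q^2$; the weight of a point $\langle v\rangle$ is $\dim_{\mathbb{F}_2}(W\cap\langle v\rangle_{\mathbb{F}_q})$; an $i$-club of rank $k$ is such a set with one point (the head) of weight $i$, all others of weight $1$. For a KM-arc $\mathcal{A}$ of type $q/4$ with nucleus $N$ and $q/4$-secants $\ell_0,\dots,\ell_4$, put $S_i=\ell_i\cap\mathcal{A}$ and $D_{ij}=\{\langle P,Q\rangle\cap\ell_0: P\in S_i,Q\in S_j\}$, $1\le i<j\le4$. Property (I) w.r.t. $\ell_0$: (1) each $S_i\cup\{N\}$, $i=1,\dots,4$, is an $\mathbb{F}_2$-linear $(h-2)$-club of rank $h-1$; (2) $D_{12}=D_{34}$, $D_{13}=D_{24}$, $D_{14}=D_{23}$; (3) $D_{12}\cup\{N\},D_{13}\cup\{N\},D_{14}\cup\{N\}$ are $\mathbb{F}_2$-linear $(h-2)$-clubs of rank $h-1$ with head $N$; (4) $D_{12},D_{13},D_{14}$ are pairwise disjoint. Property (II) w.r.t. $\ell_0$: (1) and (2) as before; (3) $D_{12}\cup\{N\},D_{13}\cup\{N\},D_{14}\cup\{N\}$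 are $\mathbb{F}_2$-linear $(h-1)$-clubs of rank $h$ with head $N$; (4) $|D_{12}\cap D_{13}|=|D_{12}\cap D_{14}|=|D_{13}\cap D_{14}|=q/4$; (5) $D_{12}\cap D_{13}\cap D_{14}=\emptyset$.
   Formalization: The claim that A has property (I) or (II) is stated only for h ≥ 3; for q = 4 it fails, since S_i ∪ {N} has two points while a linear set of rank h-1 = 1 has one. The KM-arc claim is stated for all h. *)

theory Defs
  imports "HOL-Analysis.Analysis" "HOL-Library.Z2"
begin

section \<open>The prime field and the absolute trace\<close>

text \<open>\<open>\<bbbF>\<^sub>2\<close> is the library type \<^typ>\<open>bit\<close>; in a field of characteristic two,
  \<open>of_F2\<close> is its embedding as the prime subfield.\<close>

definition of_F2 :: "bit \<Rightarrow> 'a::field" where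
  "of_F2 c = (if c = 0 then 0 else 1)"

text \<open>For a field with \<open>2 ^ h\<close> elements, with values in the prime subfield.\<close>

definition abs_trace :: "nat \<Rightarrow> 'a::field \<Rightarrow> 'a" where
  "abs_trace h z = (\<Sum>i<h. z ^ (2 ^ i))"

section \<open>The plane \<open>PG(2,q)\<close>\<close>

text \<open>Points and lines are the subspaces of dimension one and two of the vector space
  \<^typ>\<open>'a ^ 3\<close>, so incidence is inclusion, the join of two points is the span of their union,
  and the intersection of two distinct lines is their common point.\<close>

type_synonym 'a subsp = "('a ^ 3) set"

definition pg_points :: "'a::field subsp set" where
  "pg_points = {P. vec.subspace P \<and> vec.dim P = 1}"

definition pg_lines :: "'a::field subsp set" where
  "pg_lines = {l. vec.subspace l \<and> vec.dim l = 2}"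

definition pt :: "'a::field \<Rightarrow> 'a \<Rightarrow> 'a \<Rightarrow> 'a subsp" where
  "pt x y z = vec.span {vector [x, y, z]}"

definition line_Z0 :: "'a::field subsp" where
  "line_Z0 = {v. v $ 3 = 0}"

definition on_line :: "'a::field subsp set \<Rightarrow> 'a subsp \<Rightarrow> 'a subsp set" where
  "on_line A l = {P \<in> A. P \<subseteq> l}"

definition KM_arc :: "nat \<Rightarrow> 'a::{field,finite} subsp set \<Rightarrow> bool" where
  "KM_arc t A \<longleftrightarrow>
     A \<subseteq> pg_points \<and> card A = CARD('a) + t \<and>
     (\<forall>l\<in>pg_lines. card (on_line A l) \<in> {0, 2, t}) \<and>
     (\<forall>m\<in>{0, 2, t}. \<exists>l\<in>pg_lines. card (on_line A l) = m)"

section \<open>Linear sets and clubs\<close>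

text \<open>Restriction of scalars to \<open>\<bbbF>\<^sub>2\<close>. This is a vector space only in characteristic two, so the
  notions of subspace and dimension are taken from the library locales with an explicit scalar
  multiplication.\<close>

definition scaleF2 :: "bit \<Rightarrow> 'a::field ^ 3 \<Rightarrow> 'a ^ 3" where
  "scaleF2 c v = of_F2 c *s v"

lemma vector_space_scaleF2:
  assumes "(1::'a::field) + 1 = 0"
  shows "vector_space (scaleF2 :: bit \<Rightarrow> 'a ^ 3 \<Rightarrow> 'a ^ 3)"
proof
  have dbl: "v + v = 0" for v :: "'a ^ 3"
  proof -
    have "v + v = (1 + 1) *s v"
      by (simp only: vec.scale_left_distrib vec.scale_one)
    then show ?thesis
      by (simp only: assms vec.scale_zero_left)
  qed
  fix a b :: bit and x y :: "'a ^ 3"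
  show "scaleF2 a (x + y) = scaleF2 a x + scaleF2 a y"
    by (simp add: scaleF2_def vec.scale_right_distrib)
  show "scaleF2 (a + b) x = scaleF2 a x + scaleF2 b x"
    by (cases a; cases b) (simp_all add: scaleF2_def of_F2_def dbl)
  show "scaleF2 a (scaleF2 b x) = scaleF2 (a * b) x"
    by (cases a; cases b) (simp_all add: scaleF2_def of_F2_def)
  show "scaleF2 1 x = x"
    by (simp add: scaleF2_def of_F2_def)
qed

abbreviation subspaceF2 :: "('a::field ^ 3) set \<Rightarrow> bool" where
  "subspaceF2 \<equiv> module.subspace scaleF2"

abbreviation dimF2 :: "('a::field ^ 3) set \<Rightarrow> nat" where
  "dimF2 \<equiv> vector_space.dim scaleF2"

definition points_of :: "('a::field ^ 3) set \<Rightarrow> 'a subsp set" where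
  "points_of W = {vec.span {v} | v. v \<in> W \<and> v \<noteq> 0}"

definition weight :: "('a::field ^ 3) set \<Rightarrow> 'a subsp \<Rightarrow> nat" where
  "weight W P = dimF2 (W \<inter> P)"

text \<open>\<open>X\<close> is an \<open>\<bbbF>\<^sub>2\<close>-linear \<open>i\<close>-club of rank \<open>k\<close> with head \<open>H\<close> on the line \<open>l\<close>. Being a vector space
  of dimension two over the whole field, \<open>l\<close> itself plays the role of the space underlying
  \<open>PG(1,q)\<close>.\<close>

definition is_club ::
    "nat \<Rightarrow> nat \<Rightarrow> 'a::field subsp \<Rightarrow> 'a subsp \<Rightarrow> 'a subsp set \<Rightarrow> bool" where
  "is_club i k l H X \<longleftrightarrow>
     (\<exists>W. subspaceF2 W \<and> W \<subseteq> l \<and> dimF2 W = k \<and> X = points_of W \<and>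
          H \<in> X \<and> weight W H = i \<and> (\<forall>P\<in>X - {H}. weight W P = 1))"

section \<open>Properties (I) and (II)\<close>

text \<open>\<open>A\<close> is a KM-arc of type \<open>q/4\<close> with nucleus \<open>N\<close> and \<open>q/4\<close>-secants \<open>l 0, \<dots>, l 4\<close>. For
  \<open>q \<ge> 16\<close> the nucleus and the set of these five lines are determined by \<open>A\<close>, and \<open>N\<close> is not in
  \<open>A\<close>. For \<open>q = 8\<close> the arc is a hyperoval, all of whose secants are \<open>q/4\<close>-secants; there, any
  point off the hyperoval may serve as \<open>N\<close>, together with the five secants through it.\<close>

definition KM_quarter ::
    "'a::{field,finite} subsp set \<Rightarrow> 'a subsp \<Rightarrow> (nat \<Rightarrow> 'a subsp) \<Rightarrow> bool" where
  "KM_quarter A N l \<longleftrightarrow>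
     KM_arc (CARD('a) div 4) A \<and> N \<in> pg_points \<and> N \<notin> A \<and> inj_on l {0..4} \<and>
     (\<forall>i\<in>{0..4}. l i \<in> pg_lines \<and> N \<subseteq> l i \<and> card (on_line A (l i)) = CARD('a) div 4)"

definition Dset ::
    "'a::field subsp set \<Rightarrow> (nat \<Rightarrow> 'a subsp) \<Rightarrow> nat \<Rightarrow> nat \<Rightarrow> 'a subsp set" where
  "Dset A l i j =
     {vec.span (P \<union> Q) \<inter> l 0 | P Q. P \<in> on_line A (l i) \<and> Q \<in> on_line A (l j)}"

text \<open>Items (1) and (2), common to both properties; \<open>2 ^ h\<close> is the order of the field.\<close>

definition common_12 ::
    "nat \<Rightarrow> 'a::field subsp set \<Rightarrow> 'a subsp \<Rightarrow> (nat \<Rightarrow> 'a subsp) \<Rightarrow> bool" where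
  "common_12 h A N l \<longleftrightarrow>
     (\<forall>i\<in>{1..4}. \<exists>H. is_club (h - 2) (h - 1) (l i) H (insert N (on_line A (l i)))) \<and>
     Dset A l 1 2 = Dset A l 3 4 \<and>
     Dset A l 1 3 = Dset A l 2 4 \<and>
     Dset A l 1 4 = Dset A l 2 3"

text \<open>The conditions do not depend on the order in which the secants other than \<open>l0\<close> are
  numbered.\<close>

definition property_I ::
    "nat \<Rightarrow> 'a::{field,finite} subsp set \<Rightarrow> 'a subsp \<Rightarrow> bool" where
  "property_I h A l0 \<longleftrightarrow>
     (\<exists>N l. KM_quarter A N l \<and> l 0 = l0 \<and> common_12 h A N l \<and>
        (\<forall>j\<in>{2..4}. is_club (h - 2) (h - 1) l0 N (insert N (Dset A l 1 j))) \<and>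
        Dset A l 1 2 \<inter> Dset A l 1 3 = {} \<and>
        Dset A l 1 2 \<inter> Dset A l 1 4 = {} \<and>
        Dset A l 1 3 \<inter> Dset A l 1 4 = {})"

definition property_II ::
    "nat \<Rightarrow> 'a::{field,finite} subsp set \<Rightarrow> 'a subsp \<Rightarrow> bool" where
  "property_II h A l0 \<longleftrightarrow>
     (\<exists>N l. KM_quarter A N l \<and> l 0 = l0 \<and> common_12 h A N l \<and>
        (\<forall>j\<in>{2..4}. is_club (h - 1) h l0 N (insert N (Dset A l 1 j))) \<and>
        card (Dset A l 1 2 \<inter> Dset A l 1 3) = CARD('a) div 4 \<and>
        card (Dset A l 1 2 \<inter> Dset A l 1 4) = CARD('a) div 4 \<and>
        card (Dset A l 1 3 \<inter> Dset A l 1 4) = CARD('a) div 4 \<and>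
        Dset A l 1 2 \<inter> Dset A l 1 3 \<inter> Dset A l 1 4 = {})"

end

theory Submission
  imports Defs
begin

text \<open>
  A line through \<open>N = (1,0,0)\<close> contains one of the \<open>S\<^sub>i\<close> or misses the arc. Any other line
  \<open>X = uY + wZ\<close> has one point on each of the five secants, and whether that point lies in \<open>S\<^sub>i\<close>
  is decided by two \<open>\<bbbF>\<^sub>2\<close>-linear conditions on the traces of \<open>u\<close>, \<open>u/\<alpha>\<close>, \<open>u/(\<alpha>\<beta>)\<close>, \<open>w\<close>,
  \<open>w/(\<alpha>\<gamma>)\<close> and \<open>w/(\<alpha>\<beta>)\<close>. Every assignment of values to these traces satisfies the conditions of
  none or of exactly two of the \<open>S\<^sub>i\<close>. The point \<open>(u,1,0)\<close> lies in \<open>D\<^sub>i\<^sub>j\<close> iff for some \<open>w\<close> the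
  conditions of \<open>S\<^sub>i\<close> and \<open>S\<^sub>j\<close> hold. If \<open>1\<close>, \<open>1/(\<alpha>\<gamma>)\<close>, \<open>1/(\<alpha>\<beta>)\<close> are independent over
  \<open>\<bbbF>\<^sub>2\<close>, the traces of the multiples of \<open>w\<close> are arbitrary, the \<open>D\<^sub>i\<^sub>j\<close> are affine hyperplanes and
  property (II) holds. The only possible dependency is \<open>1/(\<alpha>\<gamma>) = 1/(\<alpha>\<beta>)\<close>; then the \<open>D\<^sub>i\<^sub>j\<close> have
  codimension two and property (I) holds.
\<close>

section \<open>Fields of even order and the trace\<close>

text \<open>Translation by 1 permutes the field, so the sum of all elements is unchanged when
  \<open>CARD('a)\<close> copies of 1 are added. Hence 2 ^ \<open>h\<close> is 0 in the field, and
  so is 2.\<close>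

lemma even_field_one_plus_one:
  assumes "CARD('a::{field,finite}) = 2 ^ h"
  shows "(1::'a) + 1 = 0"
proof -
  have "(\<Sum>x\<in>UNIV. x + 1 :: 'a) = \<Sum>UNIV"
    by (rule sum.reindex_bij_betw[where g = "\<lambda>x. x"]) (rule bij_plus_right)
  then have "of_nat CARD('a) = (0::'a)"
    by (simp add: sum.distrib)
  then have "(2::'a) ^ h = 0"
    by (simp add: assms)
  then show ?thesis
    by simp
qed

text \<open>Multiplication by a nonzero \<open>x\<close> permutes the nonzero elements, so their
  product absorbs the factor \<open>x ^ card ?U\<close>, which is therefore 1.\<close>

lemma power_card_eq_same:
  fixes x :: "'a::{field,finite}"
  shows "x ^ CARD('a) = x"
proof (cases "x = 0")
  case False
  let ?U = "UNIV - {0::'a}"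
  have "bij_betw ((*) x) ?U ?U"
    by (rule bij_betw_byWitness[where f' = "\<lambda>y. y / x"]) (use False in auto)
  then have "(\<Prod>y\<in>?U. x * y) = \<Prod>?U"
    by (rule prod.reindex_bij_betw)
  then have "x ^ card ?U * \<Prod>?U = \<Prod>?U"
    by (simp add: prod.distrib)
  moreover have "\<Prod>?U \<noteq> 0"
    by simp
  ultimately have "x ^ card ?U = 1"
    using mult_cancel_right2[of "x ^ card ?U" "\<Prod>?U"] by blast
  moreover have "CARD('a) = Suc (card ?U)"
    by (rule card_Suc_Diff1[symmetric]) simp_all
  ultimately show ?thesis
    by (simp only: power_Suc mult_1_right)
qed simp

lemma exists_of_F2: "(x::'a::field) \<in> {0, 1} \<Longrightarrow> \<exists>c. x = of_F2 c"
  by (auto simp: of_F2_def intro: exI[of _ 0] exI[of _ 1])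

lemma inj_of_F2: "(of_F2 c :: 'a::field) = of_F2 d \<longleftrightarrow> c = d"
  by (cases c; cases d) (simp_all add: of_F2_def)

text \<open>The geometry rests on two facts about the trace, additivity and the existence of a
  nonzero value. Values in \<open>bit\<close> instead of the prime subfield allow finite case
  distinctions.\<close>

locale even_field_functional =
  fixes h :: nat and tr :: "'a::{field,finite} \<Rightarrow> bit"
  assumes card_field: "CARD('a) = 2 ^ h"
    and tr_add: "tr (x + y) = tr x + tr y"
    and tr_nonzero: "\<exists>x. tr x \<noteq> 0"
begin

lemma one_plus_one: "(1::'a) + 1 = 0"
  by (rule even_field_one_plus_one[OF card_field])

lemma add_self: "(x::'a) + x = 0"
  using one_plus_one distrib_left[of x 1 1] by simp

lemma minus_eq_plus: "(x::'a) - y = x + y"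
  using add_self[of y] by (simp add: algebra_simps eq_neg_iff_add_eq_0)

lemma add_cancel: "(x::'a) + (x + y) = y"
  by (simp add: add_self flip: add.assoc)

lemma add_eq_0_iff_eq: "(x::'a) + y = 0 \<longleftrightarrow> x = y"
  by (simp flip: minus_eq_plus)

lemma tr_0: "tr 0 = 0"
  using tr_add[of 0 0] by simp

end

text \<open>Additivity comes from the Frobenius map. The values lie in the prime subfield because
  squaring permutes the summands cyclically. The trace is not identically 0, being given by a
  nonzero polynomial of degree at most 2 ^ (\<open>h\<close> - 1), which is less than the order of
  the field.\<close>

lemma abs_trace_functional:
  assumes card: "CARD('a::{field,finite}) = 2 ^ h"
  obtains tr :: "'a::{field,finite} \<Rightarrow> bit" where "even_field_functional h tr" and "\<And>z. abs_trace h z = of_F2 (tr z)"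
proof -
  have two: "(2::'a) = 0"
    using even_field_one_plus_one[OF card] by simp
  have "CARD('a) \<noteq> 1"
    by (metis card_1_singletonE UNIV_I singletonD zero_neq_one)
  then obtain n where h: "h = Suc n"
    using card by (cases h) auto
  have frob: "(x + y) ^ (2 ^ i) = x ^ (2 ^ i) + y ^ (2 ^ i)" for x y :: 'a and i
    by (induction i) (simp_all only: power_Suc2 power_mult power2_sum two mult_zero_left add_0_right power_0 power_one_right)
  have add: "abs_trace h (x + y) = abs_trace h x + abs_trace h y" for x y :: 'a
    by (simp add: abs_trace_def frob sum.distrib)
  have sq: "(\<Sum>i\<in>I. f i)\<^sup>2 = (\<Sum>i\<in>I. (f i)\<^sup>2)" if "finite I" for f :: "nat \<Rightarrow> 'a" and I
    using that by induction (simp_all add: power2_sum two)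
  have idem: "(abs_trace h z)\<^sup>2 = abs_trace h z" for z :: 'a
  proof -
    have "(abs_trace h z)\<^sup>2 = (\<Sum>i<h. z ^ (2 ^ Suc i))"
      by (simp only: abs_trace_def sq[OF finite_lessThan] power_Suc2 power_mult)
    \<comment> \<open>Adding \<open>z\<close> completes the shifted sum to the exponents 2 ^ 0 up to
      2 ^ \<open>h\<close>; the top term is \<open>z\<close> again.\<close>
    also have "\<dots> + z = (\<Sum>i<Suc h. z ^ (2 ^ i))"
      by (subst sum.lessThan_Suc_shift) simp
    also have "\<dots> = abs_trace h z + z"
      using power_card_eq_same[of z] by (simp add: abs_trace_def card)
    finally show ?thesis
      by simp
  qed
  have "\<exists>c. abs_trace h z = of_F2 c" for z :: 'a
    using idem[of z] by (intro exists_of_F2) (simp add: power2_eq_square)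
  then obtain tr where tr: "\<And>z::'a. abs_trace h z = of_F2 (tr z)"
    by metis
  have "\<exists>z::'a. abs_trace h z \<noteq> 0"
  proof (rule ccontr)
    assume *: "\<not> ?thesis"
    let ?p = "\<Sum>i<h. monom (1::'a) (2 ^ i)"
    have "coeff ?p 1 = (\<Sum>i<h. if i = 0 then 1 else 0)"
      by (simp add: coeff_sum)
    then have "coeff ?p 1 = 1"
      by (simp add: h)
    then have "?p \<noteq> 0"
      by auto
    then have "card {z. poly ?p z = 0} \<le> degree ?p"
      by (rule card_poly_roots_bound)
    moreover have "poly ?p z = 0" for z
      using * by (simp add: poly_sum poly_monom abs_trace_def)
    moreover have "degree ?p \<le> 2 ^ n"
      by (rule degree_sum_le) (auto simp: h degree_monom_eq power_increasing)
    ultimately have "CARD('a) \<le> 2 ^ n"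
      by simp
    then show False
      by (simp add: card h)
  qed
  then have nz: "\<exists>z. tr z \<noteq> 0"
    by (metis tr of_F2_def)
  have "tr (x + y) = tr x + tr y" for x y
    using add[of x y] two
    by (cases "tr x"; cases "tr y"; cases "tr (x + y)") (simp_all add: tr of_F2_def)
  then have "even_field_functional h tr"
    using card nz by unfold_locales
  then show thesis
    using that tr by blast
qed

section \<open>Joint values of several functionals \<open>tr (z * c)\<close> and the sizes of their
  level sets\<close>

context even_field_functional
begin

lemma tr_scaled_nonzero: "c \<noteq> 0 \<Longrightarrow> \<exists>z. tr (z * c) = 1"
  using tr_nonzero by (metis bit_not_zero_iff nonzero_divide_eq_eq)

lemma tr_lin: "tr ((x + y) * c) = tr (x * c) + tr (y * c)"
  by (simp add: distrib_right tr_add)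

text \<open>The element \<open>w'\<close> has different traces at \<open>c\<close> and
  \<open>d\<close>, since \<open>tr (w' * (c + d))\<close> is 1. One of \<open>w\<close>,
  \<open>w'\<close>, \<open>w + w'\<close> is a witness.\<close>

lemma functionals_1_0:
  assumes "c \<noteq> 0" "c \<noteq> d"
  shows "\<exists>z. tr (z * c) = 1 \<and> tr (z * d) = 0"
proof -
  obtain w where w: "tr (w * c) = 1"
    using tr_scaled_nonzero[OF assms(1)] by blast
  have "c + d \<noteq> 0"
    using assms by (simp add: add_eq_0_iff_eq)
  then obtain w' where w': "tr (w' * c) + tr (w' * d) = 1"
    using tr_scaled_nonzero by (metis distrib_left tr_add)
  have "tr ((w + w') * c) = tr (w * c) + tr (w' * c)" "tr ((w + w') * d) = tr (w * d) + tr (w' * d)"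
    by (rule tr_lin)+
  then show ?thesis
    using w w' by (cases "tr (w * d)"; cases "tr (w' * d)"; cases "tr (w' * c)") auto
qed

text \<open>The hypotheses put \<open>c\<close> outside the span of \<open>d\<close> and
  \<open>e\<close> over the prime field. If none of \<open>w1\<close>, \<open>w2\<close>,
  \<open>w3\<close> is a witness, their values at (\<open>c\<close>, \<open>d\<close>,
  \<open>e\<close>) are (1,0,1), (1,1,0), (1,1,1), which add up to (1,0,0).\<close>

lemma functionals_1_0_0:
  assumes "c \<noteq> 0" "c \<noteq> d" "c \<noteq> e" "c \<noteq> d + e"
  shows "\<exists>z. tr (z * c) = 1 \<and> tr (z * d) = 0 \<and> tr (z * e) = 0"
proof -
  obtain w1 where "tr (w1 * c) = 1 \<and> tr (w1 * d) = 0"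
    using functionals_1_0 assms by blast
  moreover obtain w2 where "tr (w2 * c) = 1 \<and> tr (w2 * e) = 0"
    using functionals_1_0 assms by blast
  moreover obtain w3 where "tr (w3 * c) = 1 \<and> tr (w3 * d) + tr (w3 * e) = 0"
    using functionals_1_0[OF assms(1,4)] by (auto simp: distrib_left tr_add)
  moreover have "tr ((w1 + w2 + w3) * x) = tr (w1 * x) + tr (w2 * x) + tr (w3 * x)" for x
    by (simp add: tr_lin)
  ultimately show ?thesis
    by (intro exI[of _ "if tr (w1 * e) = 0 then w1 else if tr (w2 * d) = 0 then w2
        else if tr (w3 * d) = 0 then w3 else w1 + w2 + w3"])
      (cases "tr (w3 * d)"; cases "tr (w3 * e)"; simp)
qed

lemma functionals_surj_2:
  assumes "c \<noteq> 0" "d \<noteq> 0" "c \<noteq> d"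
  shows "\<exists>z. tr (z * c) = r \<and> tr (z * d) = s"
proof -
  obtain w1 where "tr (w1 * c) = 1" "tr (w1 * d) = 0"
    using functionals_1_0 assms by blast
  moreover obtain w2 where "tr (w2 * c) = 0" "tr (w2 * d) = 1"
    using functionals_1_0[of d c] assms by blast
  moreover have "tr ((w1 + w2) * x) = tr (w1 * x) + tr (w2 * x)" "tr (0 * x) = 0" for x
    by (simp_all add: tr_lin tr_0)
  ultimately show ?thesis
    by (intro exI[of _ "(if r = 1 then w1 else 0) + (if s = 1 then w2 else 0)"])
      (cases r; cases s; simp)
qed

text \<open>The hypotheses express independence of \<open>c\<close>, \<open>d\<close>,
  \<open>e\<close> over the prime field. Once \<open>w2\<close> has the right values at
  \<open>d\<close> and \<open>e\<close>, adding \<open>w1\<close> changes only the value at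
  \<open>c\<close>.\<close>

lemma functionals_surj_3:
  assumes "c \<noteq> 0" "d \<noteq> 0" "e \<noteq> 0" "c \<noteq> d" "c \<noteq> e" "d \<noteq> e" "c + d + e \<noteq> 0"
  shows "\<exists>z. tr (z * c) = r \<and> tr (z * d) = s \<and> tr (z * e) = t"
proof -
  have ne: "c \<noteq> d + e" "e \<noteq> c + d"
    using assms(7) add_eq_0_iff_eq[of c "d + e"] add_eq_0_iff_eq[of "c + d" e] by (auto simp: add.assoc)
  obtain w1 where w1: "tr (w1 * c) = 1" "tr (w1 * d) = 0" "tr (w1 * e) = 0"
    using functionals_1_0_0[of c d e] assms ne by blast
  obtain w2 where w2: "tr (w2 * d) = s" "tr (w2 * e) = t"
    using functionals_surj_2[of d e] assms by blast
  show ?thesis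
  proof (cases "tr (w2 * c) = r")
    case False
    then have "tr (w1 * c) + tr (w2 * c) = r"
      using w1 by (cases r; cases "tr (w2 * c)") simp_all
    then show ?thesis
      using w1 w2 by (intro exI[of _ "w1 + w2"]) (simp add: tr_lin)
  qed (use w2 in blast)
qed

text \<open>Translation by \<open>w\<close> exchanges the two level sets inside
  \<open>C\<close>.\<close>

lemma card_halve:
  fixes C :: "'a set"
  assumes "\<And>z. z \<in> C \<Longrightarrow> z + w \<in> C" and "tr (w * c) = 1"
  shows "2 * card {z \<in> C. tr (z * c) = r} = card C"
proof -
  have "bij_betw (\<lambda>z. z + w) {z \<in> C. tr (z * c) = r} {z \<in> C. tr (z * c) \<noteq> r}"
    by (rule bij_betw_byWitness[where f' = "\<lambda>z. z + w"])
      (use assms in \<open>cases r; auto simp: tr_lin add.assoc add_self\<close>)+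
  then have "card {z \<in> C. tr (z * c) = r} = card {z \<in> C. tr (z * c) \<noteq> r}"
    by (rule bij_betw_same_card)
  moreover have "card C = card {z \<in> C. tr (z * c) = r} + card {z \<in> C. tr (z * c) \<noteq> r}"
    by (subst card_Un_disjoint[symmetric]) (auto intro: arg_cong[where f = card])
  ultimately show ?thesis
    by simp
qed

lemma card_hyperplane: "c \<noteq> 0 \<Longrightarrow> 2 * card {z. tr (z * c) = r} = CARD('a)"
  using tr_scaled_nonzero[of c] card_halve[of UNIV _ c r] by auto

lemma card_codim_2:
  assumes "c \<noteq> 0" "d \<noteq> 0" "c \<noteq> d"
  shows "4 * card {z. tr (z * c) = r \<and> tr (z * d) = s} = CARD('a)"
proof -
  obtain w where "tr (w * d) = 1" "tr (w * c) = 0"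
    using functionals_1_0[of d c] assms by blast
  then have "2 * card {z \<in> {z. tr (z * c) = r}. tr (z * d) = s} = card {z. tr (z * c) = r}"
    by (intro card_halve) (auto simp: tr_lin)
  then show ?thesis
    using card_hyperplane[OF assms(1), of r] by simp
qed

end

section \<open>Dimension over the prime field\<close>

text \<open>Adjoining an independent vector \<open>b\<close> adds a disjoint translate of the span
  and so doubles it. This turns dimensions of linear sets into counts.\<close>

lemma card_F2_subspace:
  fixes W :: "('a::{field,finite} ^ 3) set"
  assumes char: "(1::'a) + 1 = 0" and W: "subspaceF2 W"
  shows "card W = 2 ^ dimF2 W"
proof -
  interpret F2: vector_space "scaleF2 :: bit \<Rightarrow> 'a ^ 3 \<Rightarrow> 'a ^ 3"
    by (rule vector_space_scaleF2[OF char])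
  have card_span: "card (F2.span B) = 2 ^ card B" if "finite B" "F2.independent B" for B
    using that
  proof (induction B)
    case (insert b B)
    then have b: "b \<notin> F2.span B" and "F2.independent B"
      by (auto simp: F2.independent_insert)
    have "F2.span (insert b B) = F2.span B \<union> (+) b ` F2.span B"
    proof -
      have "x \<in> F2.span (insert b B) \<longleftrightarrow> x - scaleF2 0 b \<in> F2.span B \<or> x - scaleF2 1 b \<in> F2.span B" for x
        unfolding F2.span_breakdown_eq[of _ b] by (metis bit.exhaust)
      moreover have "x - b \<in> F2.span B \<longleftrightarrow> x \<in> (+) b ` F2.span B" for x
        by (metis (no_types, lifting) add.commute diff_add_cancel add_diff_cancel_left' image_iff)
      ultimately show ?thesis
        by auto
    qed
    moreover have "F2.span B \<inter> (+) b ` F2.span B = {}"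
    proof -
      have "b + x \<notin> F2.span B" if "x \<in> F2.span B" for x
        using b that F2.span_diff[of "b + x" B x] by auto
      then show ?thesis by auto
    qed
    moreover have "card ((+) b ` F2.span B) = card (F2.span B)"
      by (simp add: card_image)
    ultimately show ?case
      using insert \<open>F2.independent B\<close> by (simp add: card_Un_disjoint)
  qed simp
  obtain B where B: "B \<subseteq> W" "F2.independent B" "W \<subseteq> F2.span B" "card B = F2.dim W"
    using F2.basis_exists by blast
  then have "F2.span B = W"
    using F2.span_minimal[OF B(1) W] by blast
  then show ?thesis
    using card_span[of B] B by simp
qed

lemma subspaceF2_iff: "subspaceF2 (W :: ('a::field ^ 3) set) \<longleftrightarrow> 0 \<in> W \<and> (\<forall>v\<in>W. \<forall>w\<in>W. v + w \<in> W)"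
  if "(1::'a) + 1 = 0"
proof -
  interpret F2: vector_space "scaleF2 :: bit \<Rightarrow> 'a ^ 3 \<Rightarrow> 'a ^ 3"
    by (rule vector_space_scaleF2[OF that])
  have "scaleF2 0 v = 0" "scaleF2 1 v = v" for v :: "'a ^ 3"
    by (simp_all add: scaleF2_def of_F2_def)
  moreover have "(\<forall>c. P c) \<longleftrightarrow> P 0 \<and> P 1" for P :: "bit \<Rightarrow> bool"
    by (metis bit.exhaust)
  ultimately show ?thesis
    unfolding F2.subspace_def by auto
qed

lemma dimF2_eqI:
  fixes W :: "('a::{field,finite} ^ 3) set"
  assumes "(1::'a) + 1 = 0" "subspaceF2 W" "card W = 2 ^ k"
  shows "dimF2 W = k"
  using card_F2_subspace[OF assms(1,2)] assms(3) by simp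

section \<open>Points and lines in coordinates\<close>

lemma vec3_eq_iff: "v = w \<longleftrightarrow> v $ 1 = w $ 1 \<and> v $ 2 = w $ 2 \<and> v $ 3 = w $ 3" for v w :: "'a ^ 3"
  by (simp add: vec_eq_iff forall_3)

lemma mem_pt: "v \<in> pt x y z \<longleftrightarrow> (\<exists>k. v = vector [k * x, k * y, k * z])" for x :: "'a::field"
  by (auto simp: pt_def vec.span_singleton vec3_eq_iff vector_3)

lemma pt_subset_iff: "vec.subspace l \<Longrightarrow> pt x y z \<subseteq> l \<longleftrightarrow> vector [x, y, z] \<in> l"
  unfolding pt_def using vec.span_minimal[of "{vector [x, y, z]}" l] vec.span_base[of "vector [x, y, z]" "{vector [x, y, z]}"]
  by blast

lemma pt_eqD:
  fixes x :: "'a::field"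
  assumes "pt z y x = pt z' y' x'"
  obtains k where "z = k * z'" "y = k * y'" "x = k * x'"
proof -
  have "vector [z, y, x] \<in> pt z' y' x'"
    unfolding assms[symmetric] mem_pt by (rule exI[of _ 1]) simp
  then show thesis
    using that by (auto simp: mem_pt vec3_eq_iff vector_3)
qed

lemma pt_inj: "pt z y x = pt z' y x \<longleftrightarrow> z = z'" if "y \<noteq> 0 \<or> x \<noteq> 0" for x :: "'a::field"
  using that by (auto elim!: pt_eqD)

lemma pt_in_pg_points: "x \<noteq> 0 \<or> y \<noteq> 0 \<or> z \<noteq> 0 \<Longrightarrow> pt x y z \<in> pg_points"
  unfolding pg_points_def pt_def by (auto simp: vec3_eq_iff vector_3)

lemma pt_horizontal: "x \<noteq> 0 \<Longrightarrow> pt x 0 0 = pt 1 0 0" for x :: "'a::field"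
proof -
  assume "x \<noteq> 0"
  then have "\<exists>k. c = k * x" for c
    by (intro exI[of _ "c / x"]) simp
  then show ?thesis
    by (auto simp: mem_pt vec3_eq_iff vector_3)
qed

text \<open>The line joining (1,0,0) to (0,\<open>y\<close>,\<open>x\<close>), provided
  \<open>y\<close> and \<open>x\<close> are not both 0.\<close>

definition pencil_line :: "'a::field \<Rightarrow> 'a \<Rightarrow> 'a subsp" where
  "pencil_line y x = {v. x * v $ 2 = y * v $ 3}"

definition transversal :: "'a::field \<Rightarrow> 'a \<Rightarrow> 'a subsp" where
  "transversal u w = {v. v $ 1 = u * v $ 2 + w * v $ 3}"

lemma span_pair: "v \<in> vec.span {a, b} \<longleftrightarrow> (\<exists>k l. v = k *s a + l *s b)" for v :: "'a::field ^ 3"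
proof -
  have "v - k *s a = l *s b \<longleftrightarrow> v = k *s a + l *s b" for k l
    by (auto simp: algebra_simps)
  then show ?thesis
    by (auto simp: vec.span_insert[of a] vec.span_singleton)
qed

lemma pair_span_in_pg_lines:
  fixes a b :: "'a::field ^ 3"
  assumes "b \<noteq> 0" "\<And>k. a \<noteq> k *s b"
  shows "vec.span {a, b} \<in> pg_lines"
proof -
  have "a \<notin> vec.span {b}" "a \<noteq> b"
    using assms assms(2)[of 1] by (auto simp: vec.span_singleton)
  then have "vec.dim {a, b} = 2"
    using assms(1) by (simp add: vec.dim_insert)
  then show ?thesis
    by (simp add: pg_lines_def)
qed

lemma pencil_line_in_pg_lines:
  assumes "y \<noteq> 0 \<or> x \<noteq> 0"
  shows "pencil_line y x \<in> pg_lines"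
proof -
  have "pencil_line y x = vec.span {vector [1, 0, 0], vector [0, y, x]}"
  proof -
    have "\<exists>l. v $ 2 = l * y \<and> v $ 3 = l * x" if "x * v $ 2 = y * v $ 3" for v :: "'a ^ 3"
    proof (cases "y = 0")
      case True
      then show ?thesis
        using assms that by (intro exI[of _ "v $ 3 / x"]) auto
    next
      case False
      then show ?thesis
        using that by (intro exI[of _ "v $ 2 / y"]) (simp add: field_simps)
    qed
    then show ?thesis
      by (fastforce simp: pencil_line_def span_pair vec3_eq_iff vector_3)
  qed
  then show ?thesis
    using assms by (auto simp: vec3_eq_iff vector_3 intro!: pair_span_in_pg_lines)
qed

lemma transversal_in_pg_lines: "transversal u w \<in> pg_lines"
proof -
  have "transversal u w = vec.span {vector [u, 1, 0], vector [w, 0, 1]}"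
    by (auto simp: transversal_def span_pair vec3_eq_iff vector_3 mult.commute)
  then show ?thesis
    by (auto simp: vec3_eq_iff vector_3 intro!: pair_span_in_pg_lines)
qed

lemma pg_lines_eqI: "l \<in> pg_lines \<Longrightarrow> m \<in> pg_lines \<Longrightarrow> l \<subseteq> m \<Longrightarrow> l = m"
  by (auto simp: pg_lines_def vec.subspace_dim_equal)

lemma pg_lines_cases:
  fixes l :: "'a::field subsp"
  assumes l: "l \<in> pg_lines"
  obtains (pencil) y x where "y \<noteq> 0 \<or> x \<noteq> 0" "l = pencil_line y x"
    | (transversal) u w where "l = transversal u w"
proof -
  let ?e = "vector [1, 0, 0] :: 'a ^ 3"
  have sub: "vec.subspace l" and dim: "vec.dim l = 2"
    using l by (auto simp: pg_lines_def)
  show thesis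
  proof (cases "?e \<in> l")
    case True
    have "\<not> l \<subseteq> vec.span {?e}"
    proof
      assume "l \<subseteq> vec.span {?e}"
      then have "vec.dim l \<le> vec.dim {?e}"
        by (metis vec.dim_span vec.dim_subset)
      then show False
        by (simp add: dim split: if_splits)
    qed
    then obtain v where v: "v \<in> l" "v \<notin> vec.span {?e}"
      by blast
    have "v = v $ 1 *s ?e" if "v $ 2 = 0" "v $ 3 = 0"
      using that by (simp add: vec3_eq_iff vector_3)
    then have nz: "v $ 2 \<noteq> 0 \<or> v $ 3 \<noteq> 0"
      using v(2) by (auto simp: vec.span_singleton)
    have "vec.span {?e, v} \<subseteq> l"
      using True v(1) sub by (intro vec.span_minimal) auto
    moreover have "vec.span {?e, v} \<in> pg_lines" "vec.span {?e, v} \<subseteq> pencil_line (v $ 2) (v $ 3)"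
      using nz by (auto simp: vec3_eq_iff vector_3 pencil_line_def span_pair intro!: pair_span_in_pg_lines)
    ultimately have "l = pencil_line (v $ 2) (v $ 3)"
      using pg_lines_eqI l pencil_line_in_pg_lines[OF nz] by metis
    then show thesis
      using pencil nz by blast
  next
    case False
    have "vec.dim (insert ?e l) = 3"
      using False dim sub by (simp add: vec.dim_insert vec.span_eq_iff[THEN iffD2])
    then have "vec.span (insert ?e l) = UNIV"
      by (subst vec.dim_eq_full[symmetric]) (simp add: vec.dimension_def card_cart_basis vec.dim_UNIV)
    \<comment> \<open>Since \<open>?e\<close> and \<open>l\<close> span the space, every vector can
      be moved into \<open>l\<close> along \<open>?e\<close>; applied to the other two unit vectors
      this gives a basis of \<open>l\<close>.\<close>
    then have "\<exists>k. v - k *s ?e \<in> l" for v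
      using vec.span_breakdown_eq[of v ?e l] sub by (auto simp: vec.span_eq_iff[THEN iffD2])
    then obtain u w where "vector [0, 1, 0] - u *s ?e \<in> l" "vector [0, 0, 1] - w *s ?e \<in> l"
      by metis
    moreover have "vector [0, 1, 0] - u *s ?e = vector [- u, 1, 0]" "vector [0, 0, 1] - w *s ?e = vector [- w, 0, 1]"
      by (simp_all add: vec3_eq_iff vector_3)
    ultimately have "vec.span {vector [- u, 1, 0], vector [- w, 0, 1]} \<subseteq> l"
      using sub by (intro vec.span_minimal) simp_all
    moreover have "transversal (- u) (- w) \<subseteq> vec.span {vector [- u, 1, 0], vector [- w, 0, 1]}"
      by (auto simp: transversal_def span_pair vec3_eq_iff vector_3 mult.commute)
    ultimately have "l = transversal (- u) (- w)"
      using pg_lines_eqI[OF transversal_in_pg_lines l] by blast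
    then show thesis
      using transversal by blast
  qed
qed

lemma pt_subset_pencil_line: "pt z y x \<subseteq> pencil_line y' x' \<longleftrightarrow> x' * y = y' * x"
  if "y' \<noteq> 0 \<or> x' \<noteq> 0"
  using pencil_line_in_pg_lines[OF that]
  by (simp add: pt_subset_iff pg_lines_def) (simp add: pencil_line_def vector_3)

lemma pt_subset_transversal: "pt z y x \<subseteq> transversal u w \<longleftrightarrow> z = u * y + w * x"
  using transversal_in_pg_lines[of u w]
  by (simp add: pt_subset_iff pg_lines_def) (simp add: transversal_def vector_3)

text \<open>The combinations with third coordinate 0 are the multiples of the difference of the two
  vectors; division by \<open>y - y'\<close> makes its second coordinate 1.\<close>

lemma join_meet_line_Z0:
  fixes y y' :: "'a::field"
  assumes "y \<noteq> y'"
  shows "vec.span (pt z y 1 \<union> pt z' y' 1) \<inter> line_Z0 = pt ((z - z') / (y - y')) 1 0"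
proof -
  have "vec.span (pt z y 1 \<union> pt z' y' 1) = vec.span {vector [z, y, 1], vector [z', y', 1]}"
    unfolding pt_def vec.span_Un vec.span_span
    by (subst insert_is_Un) (simp only: vec.span_Un)
  moreover have "v \<in> vec.span {vector [z, y, 1], vector [z', y', 1]} \<inter> line_Z0 \<longleftrightarrow>
      v \<in> pt ((z - z') / (y - y')) 1 0" (is "?L \<longleftrightarrow> ?R") for v
  proof
    assume ?L
    then obtain k l where v: "v = k *s vector [z, y, 1] + l *s vector [z', y', 1]" and "v $ 3 = 0"
      by (auto simp: span_pair line_Z0_def)
    then have "l = - k"
      by (simp add: vector_3 eq_neg_iff_add_eq_0 add.commute)
    moreover have "k * (y - y') * ((z - z') / (y - y')) = k * (z - z')"
      using assms by simp
    ultimately show ?R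
      unfolding mem_pt
      by (intro exI[of _ "k * (y - y')"]) (simp add: v vec3_eq_iff vector_3 right_diff_distrib)
  next
    assume ?R
    then obtain k where k: "v = vector [k * ((z - z') / (y - y')), k, 0]"
      by (auto simp: mem_pt)
    let ?c = "k / (y - y')"
    have "k * y / (y - y') - k * y' / (y - y') = k"
      using assms by (simp flip: diff_divide_distrib right_diff_distrib)
    then have "v = ?c *s vector [z, y, 1] + (- ?c) *s vector [z', y', 1]"
      by (simp add: k vec3_eq_iff vector_3 diff_divide_distrib right_diff_distrib)
    then have "v \<in> vec.span {vector [z, y, 1], vector [z', y', 1]}"
      unfolding span_pair by blast
    then show ?L
      by (simp add: k line_Z0_def vector_3)
  qed
  ultimately show ?thesis
    by blast
qed

section \<open>Clubs\<close>

text \<open>The underlying space \<open>W\<close> is generated over the prime field by the vectors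
  (v,0,0) with v in \<open>V\<close> and by (\<open>z0\<close>,\<open>y\<close>,\<open>x\<close>).
  Its vectors on the head are those coming from \<open>V\<close>, whence the weight
  \<open>m\<close>. Any other point contains a single nonzero vector of \<open>W\<close>, because
  the last two coordinates must be exactly \<open>y\<close>, \<open>x\<close>.\<close>

lemma is_club_coset:
  fixes V :: "'a::{field,finite} set"
  assumes char: "(1::'a) + 1 = 0"
    and V: "0 \<in> V" "\<And>v w. v \<in> V \<Longrightarrow> w \<in> V \<Longrightarrow> v + w \<in> V" and card_V: "card V = 2 ^ m" "m > 0"
    and yx: "y \<noteq> 0 \<or> x \<noteq> 0"
  shows "is_club m (Suc m) (pencil_line y x) (pt 1 0 0)
    (insert (pt 1 0 0) ((\<lambda>z. pt z y x) ` {z. z + z0 \<in> V}))"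
proof -
  note dimI = dimF2_eqI[OF char] and subI = subspaceF2_iff[OF char, THEN iffD2]
  have self: "s + s = 0" for s :: 'a
    using distrib_left[of s 1 1] char by simp
  then have cancel: "s + (s + t) = t" for s t :: 'a
    by (simp flip: add.assoc)
  have two: "(2::'a) = 0"
    using char by simp
  let ?U = "{z. z + z0 \<in> V}"
  let ?g = "\<lambda>z. vector [z, 0, 0] :: 'a ^ 3" and ?f = "\<lambda>z. vector [z, y, x] :: 'a ^ 3"
  define W where "W = ?g ` V \<union> ?f ` ?U"
  have inj: "inj ?g" "inj ?f"
    by (auto simp: inj_def vec3_eq_iff vector_3)
  have card_g: "card (?g ` V) = 2 ^ m"
    using card_V inj by (simp add: card_image inj_on_def)
  have gV: "subspaceF2 (?g ` V)"
    using V by (intro subI) (auto simp: image_iff vec3_eq_iff vector_3)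
  have "bij_betw (\<lambda>z. z + z0) ?U V"
    by (rule bij_betw_byWitness[where f' = "\<lambda>z. z + z0"]) (auto simp: two add.assoc)
  then have "card ?U = 2 ^ m"
    using card_V by (simp add: bij_betw_same_card)
  then have "card (?f ` ?U) = 2 ^ m"
    using inj by (simp add: card_image inj_on_def)
  moreover have "?g ` V \<inter> ?f ` ?U = {}"
    using yx by (auto simp: vec3_eq_iff vector_3)
  ultimately have card_W: "card W = 2 ^ Suc m"
    using card_g by (simp add: W_def card_Un_disjoint)
  have W: "subspaceF2 W"
  proof (intro subI conjI ballI)
    show "0 \<in> W"
      using V by (auto simp: W_def image_iff vec3_eq_iff vector_3)
    fix v w assume "v \<in> W" "w \<in> W"
    then consider s t where "v = ?g s" "w = ?g t" "s \<in> V" "t \<in> V"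
      | s t where "v = ?g s" "w = ?f t" "s \<in> V" "t + z0 \<in> V"
      | s t where "v = ?f s" "w = ?g t" "s + z0 \<in> V" "t \<in> V"
      | s t where "v = ?f s" "w = ?f t" "s + z0 \<in> V" "t + z0 \<in> V"
      by (auto simp: W_def)
    then show "v + w \<in> W"
    proof cases
      case 1
      then have "v + w = ?g (s + t)" "s + t \<in> V"
        using V by (auto simp: vec3_eq_iff vector_3)
      then show ?thesis
        by (auto simp: W_def)
    next
      case 2
      then have "v + w = ?f (s + t)" "s + t + z0 \<in> V"
        using V(2)[of s "t + z0"] by (auto simp: vec3_eq_iff vector_3 add.assoc)
      then show ?thesis
        by (auto simp: W_def)
    next
      case 3
      then have "v + w = ?f (s + t)" "s + t + z0 \<in> V"
        using V(2)[of "s + z0" t] by (auto simp: vec3_eq_iff vector_3 add_ac)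
      then show ?thesis
        by (auto simp: W_def)
    next
      case 4
      then have "v + w = ?g (s + t)" "s + t \<in> V"
        using V(2)[of "s + z0" "t + z0"] self
        by (auto simp: vec3_eq_iff vector_3 add_ac cancel)
      then show ?thesis
        by (auto simp: W_def)
    qed
  qed
  have N_inter: "W \<inter> pt 1 0 0 = ?g ` V"
    using yx by (auto simp: W_def mem_pt vec3_eq_iff vector_3)
  have points: "points_of W = insert (pt 1 0 0) ((\<lambda>z. pt z y x) ` ?U)"
  proof -
    \<comment> \<open>A nonzero element of \<open>V\<close> is what makes the head a point of the
      linear set; the assumption \<open>m > 0\<close> enters here.\<close>
    have "V - {0} \<noteq> {}"
    proof
      assume "V - {0} = {}"
      then have "card V \<le> 1"
        using card_mono[of "{0}" V] by simp
      moreover have "(1::nat) < 2 ^ m"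
        by (rule one_less_power) (use card_V(2) in simp_all)
      ultimately show False
        using card_V(1) by simp
    qed
    moreover have "(\<lambda>z. pt z 0 0) ` (V - {0}) = (\<lambda>_. pt 1 0 0) ` (V - {0})"
      by (rule image_cong) (use pt_horizontal in blast)+
    ultimately have "(\<lambda>z. pt z 0 0) ` (V - {0}) = {pt 1 0 0}"
      by (simp only: image_constant_conv if_False)
    moreover have "?g z \<noteq> 0 \<longleftrightarrow> z \<noteq> 0" "?f z \<noteq> 0" for z
      using yx by (simp_all add: vec3_eq_iff vector_3)
    then have "W - {0} = ?g ` (V - {0}) \<union> ?f ` ?U"
      unfolding W_def by auto
    moreover have "points_of W = (\<lambda>v. vec.span {v}) ` (W - {0})"
      by (auto simp: points_of_def)
    ultimately show ?thesis
      by (simp only: image_Un image_image flip: pt_def) simp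
  qed
  have "weight W (pt z y x) = 1" if "z + z0 \<in> V" for z
  proof -
    have "W \<inter> pt z y x = {0, ?f z}"
      using yx that V by (auto simp: W_def mem_pt vec3_eq_iff vector_3 image_iff)
    moreover have "subspaceF2 {0, ?f z}"
      using self by (intro subI) (auto simp: vec3_eq_iff vector_3)
    moreover have "card {0, ?f z} = 2 ^ 1"
      using yx by (auto simp: card_insert_if vec3_eq_iff vector_3)
    ultimately show ?thesis
      unfolding weight_def by (metis dimI)
  qed
  then show ?thesis
    unfolding is_club_def
    using W card_W points N_inter dimI[OF gV card_g] dimI[OF W card_W]
    by (intro exI[of _ W]) (auto simp: weight_def pencil_line_def W_def vector_3 mult.commute)
qed

section \<open>The construction\<close>

lemma ex_bit: "(\<exists>c. P c) \<longleftrightarrow> P 0 \<or> P (1::bit)"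
  by (metis bit.exhaust)

lemma atLeastAtMost_0_4: "{0..4::nat} = {0, 1, 2, 3, 4}"
  by (simp add: set_eq_iff) presburger

context even_field_functional
begin

text \<open>Here \<open>m\<close> is the codimension of \<open>V\<close>, whereas in
  \<open>is_club_coset\<close> it is the dimension.\<close>

lemma is_club_coset_of_kernel:
  fixes V :: "'a set"
  assumes "P = {z. z + z0 \<in> V}"
    and "0 \<in> V" "\<And>v w. v \<in> V \<Longrightarrow> w \<in> V \<Longrightarrow> v + w \<in> V" and "2 ^ m * card V = CARD('a)" "m < h"
    and "y \<noteq> 0 \<or> x \<noteq> 0"
  shows "is_club (h - m) (Suc (h - m)) (pencil_line y x) (pt 1 0 0) (insert (pt 1 0 0) ((\<lambda>z. pt z y x) ` P))"
proof -
  have "2 ^ m * card V = 2 ^ m * 2 ^ (h - m)"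
    using assms(4,5) by (simp add: card_field flip: power_add)
  then have "card V = 2 ^ (h - m)"
    by simp
  show ?thesis
    unfolding assms(1)
    by (rule is_club_coset) (use assms one_plus_one \<open>card V = 2 ^ (h - m)\<close> in auto)
qed

lemma is_club_hyperplane:
  assumes "c \<noteq> 0" "2 \<le> h" "y \<noteq> 0 \<or> x \<noteq> 0"
  shows "is_club (h - 1) h (pencil_line y x) (pt 1 0 0)
    (insert (pt 1 0 0) ((\<lambda>z. pt z y x) ` {z. tr (z * c) = r}))"
proof -
  obtain z0 where "tr (z0 * c) = r"
    using tr_scaled_nonzero[OF assms(1)] tr_0 by (metis bit.exhaust mult_zero_left)
  then have "{z. tr (z * c) = r} = {z. z + z0 \<in> {z. tr (z * c) = 0}}"
    by (cases r) (auto simp: tr_lin)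
  then show ?thesis
    using is_club_coset_of_kernel[of _ z0 "{z. tr (z * c) = 0}" 1 y x] card_hyperplane[OF assms(1), of 0] assms
    by (simp add: tr_lin tr_0)
qed

lemma is_club_codim_2:
  assumes "c \<noteq> 0" "d \<noteq> 0" "c \<noteq> d" "3 \<le> h" "y \<noteq> 0 \<or> x \<noteq> 0"
  shows "is_club (h - 2) (h - 1) (pencil_line y x) (pt 1 0 0)
    (insert (pt 1 0 0) ((\<lambda>z. pt z y x) ` {z. tr (z * c) = r \<and> tr (z * d) = s}))"
proof -
  obtain z0 where "tr (z0 * c) = r" "tr (z0 * d) = s"
    using functionals_surj_2 assms by blast
  then have "{z. tr (z * c) = r \<and> tr (z * d) = s} = {z. z + z0 \<in> {z. tr (z * c) = 0 \<and> tr (z * d) = 0}}"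
    by (cases r; cases s) (auto simp: tr_lin)
  moreover have "Suc (h - 2) = h - 1"
    using assms(4) by simp
  ultimately show ?thesis
    using is_club_coset_of_kernel[of _ z0 "{z. tr (z * c) = 0 \<and> tr (z * d) = 0}" 2 y x]
      card_codim_2[OF assms(1-3), of 0 0] assms
    by (simp add: tr_lin tr_0)
qed

end

section \<open>Parameters of the construction and the relations between them\<close>

locale km_construction = even_field_functional h tr
  for h and tr :: "'a::{field,finite} \<Rightarrow> bit" +
  fixes \<alpha> \<beta> \<gamma> \<xi> :: 'a and a b :: bit
  assumes \<alpha>: "\<alpha> \<notin> {0, 1}" and \<beta>: "\<beta> \<notin> {0, 1}" and \<alpha>\<beta>: "\<alpha> * \<beta> \<noteq> 1"
    and \<gamma>: "\<gamma> = (\<beta> + 1) / (\<alpha> * \<beta> + 1)"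
    and \<xi>: "\<xi> = \<alpha> * \<beta> * \<gamma>"
begin

text \<open>The points of \<open>S i\<close> are (z, \<open>Y i\<close>, \<open>X i\<close>), so
  \<open>X i\<close> is the third coordinate. Tables indexed by the secant let the five sets be
  treated uniformly.\<close>

definition X :: "nat \<Rightarrow> 'a" where "X i = [0, 1, 1, 1, 1] ! i"
definition Y :: "nat \<Rightarrow> 'a" where "Y i = [1, 0, 1, \<gamma>, \<beta> + 1] ! i"

definition cp where "cp = 1 / \<alpha>"
definition cg where "cg = 1 / (\<alpha> * \<gamma>)"
definition ck where "ck = 1 / (\<alpha> * \<beta>)"
definition cx where "cx = 1 / \<xi>"

definition M :: "nat \<Rightarrow> 'a" where "M i = [1, 1, 1, cg, ck] ! i"
definition M' :: "nat \<Rightarrow> 'a" where "M' i = [cp, cg, ck, cx, cx] ! i"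
definition r :: "nat \<Rightarrow> bit" where "r i = [0, 0, 1, a + 1, a + b + 1] ! i"
definition r' :: "nat \<Rightarrow> bit" where "r' i = [a, 0, b, b + 1, b] ! i"

definition T :: "nat \<Rightarrow> 'a set" where
  "T i = {z. tr (z * M i) = r i \<and> tr (z * M' i) = r' i}"

definition S :: "nat \<Rightarrow> 'a subsp set" where
  "S i = (\<lambda>z. pt z (Y i) (X i)) ` T i"

definition A :: "'a subsp set" where
  "A = (\<Union>i\<in>{0..4}. S i)"

definition secant :: "nat \<Rightarrow> 'a subsp" where
  "secant i = pencil_line (Y i) (X i)"

lemma two: "(2::'a) = 0"
  using one_plus_one by simp

lemma nonzero: "\<alpha> \<noteq> 0" "\<beta> \<noteq> 0" "\<beta> + 1 \<noteq> 0" "\<alpha> * \<beta> + 1 \<noteq> 0" "\<gamma> \<noteq> 0" "\<xi> \<noteq> 0"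
  "cp \<noteq> 0" "cg \<noteq> 0" "ck \<noteq> 0" "cx \<noteq> 0"
proof -
  show 1: "\<alpha> \<noteq> 0" "\<beta> \<noteq> 0" "\<beta> + 1 \<noteq> 0" "\<alpha> * \<beta> + 1 \<noteq> 0"
    using \<alpha> \<beta> \<alpha>\<beta> by (auto simp: add_eq_0_iff_eq)
  then show 2: "\<gamma> \<noteq> 0"
    by (simp add: \<gamma>)
  with 1 show 3: "\<xi> \<noteq> 0"
    by (simp add: \<xi>)
  show "cp \<noteq> 0" "cg \<noteq> 0" "ck \<noteq> 0" "cx \<noteq> 0"
    using 1 2 3 by (simp_all add: cp_def cg_def ck_def cx_def)
qed

text \<open>The first four identities rewrite the coefficients of \<open>u\<close> that arise on the
  third and fourth secants in terms of 1, \<open>cp\<close> and \<open>ck\<close>. The last one does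
  the same for the coefficient \<open>cx\<close> of \<open>w\<close>, in terms of 1,
  \<open>cg\<close> and \<open>ck\<close>.\<close>

lemma relations: "\<gamma> * cg = cp" "\<gamma> * cx = ck" "(\<beta> + 1) * ck = cp + ck" "(\<beta> + 1) * cx = 1 + ck" "cx = 1 + cg + ck"
proof -
  show "\<gamma> * cg = cp" "\<gamma> * cx = ck" "(\<beta> + 1) * ck = cp + ck"
    unfolding cp_def cg_def ck_def cx_def unfolding \<xi> using nonzero(1-5) by (simp_all add: field_simps)
  have cg: "cg * (\<alpha> * (\<beta> + 1)) = \<alpha> * \<beta> + 1"
    unfolding cg_def unfolding \<gamma> using nonzero(1-4) by simp
  have cx: "cx * (\<alpha> * \<beta> * (\<beta> + 1)) = \<alpha> * \<beta> + 1"
    unfolding cx_def unfolding \<xi> \<gamma> using nonzero(1-4) by simp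
  have ck: "ck * (\<alpha> * \<beta>) = 1"
    using nonzero by (simp add: ck_def)
  have "(\<beta> + 1) * cx * (\<alpha> * \<beta>) = (1 + ck) * (\<alpha> * \<beta>)"
    using cx ck by algebra
  then show "(\<beta> + 1) * cx = 1 + ck"
    using nonzero by simp
  \<comment> \<open>This holds in every field satisfying the equations for \<open>cg\<close> and
    \<open>ck\<close>; the summand with factor 2 then vanishes in characteristic two.\<close>
  have "(1 + cg + ck) * (\<alpha> * \<beta> * (\<beta> + 1)) = \<alpha> * \<beta> + 1 + 2 * (\<alpha> * \<beta> * \<beta> + \<beta>)"
    using cg ck by algebra
  then have "cx * (\<alpha> * \<beta> * (\<beta> + 1)) = (1 + cg + ck) * (\<alpha> * \<beta> * (\<beta> + 1))"
    by (simp only: cx two mult_zero_left add_0_right)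
  then show "cx = 1 + cg + ck"
    using nonzero by simp
qed

text \<open>Together with \<open>nonzero\<close>, these make \<open>M i\<close> and
  \<open>M' i\<close> independent for every secant, and leave \<open>ck = cg\<close> as the only
  possible dependency among 1, \<open>cg\<close> and \<open>ck\<close>.\<close>

lemma distinct_coeffs: "cp \<noteq> 1" "cp \<noteq> ck" "ck \<noteq> 1" "cg \<noteq> 1" "cx \<noteq> ck" "cx \<noteq> cg"
proof -
  have "\<alpha> \<noteq> 1" "\<beta> \<noteq> 1"
    using \<alpha> \<beta> by auto
  then show "cp \<noteq> 1" "cp \<noteq> ck" and ck: "ck \<noteq> 1"
    using nonzero \<alpha>\<beta> by (auto simp: cp_def ck_def field_simps)
  have "\<gamma> \<noteq> 1"
    using \<open>\<alpha> \<noteq> 1\<close> nonzero by (simp add: \<gamma>)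
  then show "cx \<noteq> ck"
    using relations(2) nonzero by auto
  then show "cg \<noteq> 1"
    using relations(5) add_cancel[of 1 ck] by (auto simp: add.assoc)
  show "cx \<noteq> cg"
  proof
    assume "cx = cg"
    then have "1 + ck = 0"
      using relations(5) by (simp add: add.commute add.left_commute)
    then show False
      using ck by (simp add: add_eq_0_iff_eq)
  qed
qed

text \<open>Cross products compare the directions (\<open>Y i\<close> : \<open>X i\<close>) of the
  secants through (1,0,0) without division.\<close>

lemma Y_X_distinct: "i \<in> {0..4} \<Longrightarrow> j \<in> {0..4} \<Longrightarrow> X j * Y i = Y j * X i \<longleftrightarrow> i = j"
proof -
  have "\<gamma> \<noteq> 1" "\<gamma> \<noteq> \<beta> + 1"
    using nonzero \<alpha> by (auto simp: \<gamma> divide_simps)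
  moreover assume "i \<in> {0..4}" "j \<in> {0..4}"
  ultimately show ?thesis
    using nonzero unfolding atLeastAtMost_0_4 by (auto simp: X_def Y_def)
qed

lemma Y_X_nonzero: "i \<in> {0..4} \<Longrightarrow> Y i \<noteq> 0 \<or> X i \<noteq> 0"
  unfolding atLeastAtMost_0_4 by (auto simp: X_def Y_def)

lemma X_1: "i \<in> {1..4} \<Longrightarrow> X i = 1"
proof -
  assume "i \<in> {1..4}"
  then have "i \<in> {0..4}" "i \<noteq> 0" by auto
  then show ?thesis
    unfolding atLeastAtMost_0_4 by (auto simp: X_def)
qed

lemma M_M': "i \<in> {0..4} \<Longrightarrow> M i \<noteq> 0 \<and> M' i \<noteq> 0 \<and> M i \<noteq> M' i"
  unfolding atLeastAtMost_0_4 using nonzero distinct_coeffs by (auto simp: M_def M'_def)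

lemma card_T: "i \<in> {0..4} \<Longrightarrow> 4 * card (T i) = CARD('a)"
  unfolding T_def using M_M' by (intro card_codim_2) auto

text \<open>The identity \<open>1/\<xi> = 1 + 1/(\<alpha>\<gamma>) + 1/(\<alpha>\<beta>)\<close> expresses the trace of \<open>w/\<xi>\<close> by the traces
  \<open>w1\<close>, \<open>wg\<close>, \<open>wk\<close> of \<open>w\<close>, \<open>w/(\<alpha>\<gamma>)\<close>, \<open>w/(\<alpha>\<beta>)\<close>.\<close>

definition meets :: "nat \<Rightarrow> bit \<Rightarrow> bit \<Rightarrow> bit \<Rightarrow> bit \<Rightarrow> bit \<Rightarrow> bit \<Rightarrow> bool" where
  "meets i u1 up uk w1 wg wk =
    [u1 = 0 \<and> up = a,
     w1 = 0 \<and> wg = 0,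
     u1 + w1 = 1 \<and> uk + wk = b,
     up + wg = a + 1 \<and> uk + (w1 + wg + wk) = b + 1,
     up + uk + wk = a + b + 1 \<and> u1 + uk + (w1 + wg + wk) = b] ! i"

lemma mem_T_iff_meets:
  assumes "i \<in> {0..4}"
  shows "u * Y i + w * X i \<in> T i \<longleftrightarrow>
    meets i (tr u) (tr (u * cp)) (tr (u * ck)) (tr w) (tr (w * cg)) (tr (w * ck))"
proof -
  have lin: "tr ((u * c + w) * d) = tr (u * (c * d)) + tr (w * d)" for c d
    by (simp add: tr_lin mult.assoc)
  have "tr ((u * \<gamma> + w) * cg) = tr (u * cp) + tr (w * cg)"
    "tr ((u * (\<beta> + 1) + w) * ck) = tr (u * cp) + tr (u * ck) + tr (w * ck)"
    "tr ((u * \<gamma> + w) * cx) = tr (u * ck) + (tr w + tr (w * cg) + tr (w * ck))"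
    "tr ((u * (\<beta> + 1) + w) * cx) = tr u + tr (u * ck) + (tr w + tr (w * cg) + tr (w * ck))"
    by (simp_all only: lin relations(1-4))
      (simp_all add: relations(5) distrib_left tr_add)
  then show ?thesis
    using assms tr_lin[of u w ck] unfolding atLeastAtMost_0_4
    by (elim insertE) (simp_all add: T_def meets_def X_def Y_def M_def M'_def r_def r'_def tr_add)
qed

text \<open>This is why a line off (1,0,0) meets the arc in 0 or 2 points. With \<open>a\<close> and
  \<open>b\<close> the conditions involve eight bits, but they depend only on the five bits
  \<open>u1\<close>, \<open>w1\<close>, \<open>wg\<close>, \<open>f\<close>, \<open>e\<close>, which
  leaves 32 cases.\<close>

lemma card_meets: "card {i \<in> {0..4}. meets i u1 up uk w1 wg wk} \<in> {0, 2}"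
proof -
  have "card {i \<in> {0..4}. P i} = (\<Sum>i\<in>{0..4}. of_bool (P i))" for P :: "nat \<Rightarrow> bool"
    by (simp add: sum_of_bool_eq Int_def)
  then have "card {i \<in> {0..4}. P i} = of_bool (P 0) + of_bool (P 1) + of_bool (P 2) + of_bool (P 3) + of_bool (P 4)"
    for P :: "nat \<Rightarrow> bool"
    unfolding atLeastAtMost_0_4 by (simp del: sum_of_bool_eq)
  then have "card {i \<in> {0..4}. meets i u1 up uk w1 wg wk} =
      of_bool (u1 = 0 \<and> up = a) + of_bool (w1 = 0 \<and> wg = 0) + of_bool (u1 + w1 = 1 \<and> uk + wk = b) +
      of_bool (up + wg = a + 1 \<and> uk + (w1 + wg + wk) = b + 1) +
      of_bool (up + uk + wk = a + b + 1 \<and> u1 + uk + (w1 + wg + wk) = b)"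
    by (simp only:) (simp add: meets_def)
  \<comment> \<open>These two sums absorb the parameters \<open>a\<close> and \<open>b\<close> as
    well as the bits \<open>up\<close>, \<open>uk\<close> and \<open>wk\<close>.\<close>
  moreover define f e where "f = up + a" and "e = uk + wk + b"
  have "up = a \<longleftrightarrow> f = 0" "up + wg = a + 1 \<longleftrightarrow> f + wg = 1"
    by (cases up; cases a; cases wg; simp add: f_def)+
  moreover have "uk + wk = b \<longleftrightarrow> e = 0"
    by (cases uk; cases wk; cases b; simp add: e_def)
  moreover have "uk + (w1 + wg + wk) = b + 1 \<longleftrightarrow> e + w1 + wg = 1"
    by (cases uk; cases wk; cases b; cases w1; cases wg; simp add: e_def)
  moreover have "up + uk + wk = a + b + 1 \<longleftrightarrow> f + e = 1"
    by (cases up; cases a; cases uk; cases wk; cases b; simp add: f_def e_def)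
  moreover have "u1 + uk + (w1 + wg + wk) = b \<longleftrightarrow> u1 + e + w1 + wg = 0"
    by (cases uk; cases wk; cases b; cases w1; cases wg; cases u1; simp add: e_def)
  moreover have "of_bool (u1 = 0 \<and> f = 0) + of_bool (w1 = 0 \<and> wg = 0) + of_bool (u1 + w1 = 1 \<and> e = 0) +
      of_bool (f + wg = 1 \<and> e + w1 + wg = 1) + of_bool (f + e = 1 \<and> u1 + e + w1 + wg = 0) \<in> {0, 2 :: nat}"
    by (cases u1; cases f; cases w1; cases wg; cases e; simp)
  ultimately show ?thesis
    by simp
qed

section \<open>Points of the arc on the lines of the plane\<close>

lemma mem_S: "P \<in> S i \<longleftrightarrow> (\<exists>z\<in>T i. P = pt z (Y i) (X i))"
  by (auto simp: S_def)

lemma pt_eq_imp_index_eq: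
  assumes "i \<in> {0..4}" "j \<in> {0..4}" "pt z (Y i) (X i) = pt z' (Y j) (X j)"
  shows "i = j"
  using assms(3) by (rule pt_eqD) (use Y_X_distinct[OF assms(1,2)] in \<open>simp add: mult_ac\<close>)

lemma card_S: "i \<in> {0..4} \<Longrightarrow> card (S i) = CARD('a) div 4"
  unfolding S_def using card_T[of i] Y_X_nonzero[of i]
  by (subst card_image) (auto simp: inj_on_def pt_inj)

lemma card_A: "card A = CARD('a) + CARD('a) div 4"
proof -
  have "card A = (\<Sum>i\<in>{0..4}. card (S i))"
    unfolding A_def
  proof (rule card_UN_disjoint)
    show "\<forall>i\<in>{0..4}. \<forall>j\<in>{0..4}. i \<noteq> j \<longrightarrow> S i \<inter> S j = {}"
      unfolding disjoint_iff mem_S using pt_eq_imp_index_eq by blast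
  qed simp_all
  also have "\<dots> = 5 * (CARD('a) div 4)"
    by (simp add: card_S)
  finally have "card A = 5 * (CARD('a) div 4)" .
  moreover have "CARD('a) = 4 * card (T 0)"
    by (rule card_T[symmetric]) simp
  ultimately show ?thesis
    by simp
qed

lemma secant_in_pg_lines: "i \<in> {0..4} \<Longrightarrow> secant i \<in> pg_lines"
  using Y_X_nonzero by (simp add: secant_def pencil_line_in_pg_lines)

lemma mem_on_line:
  "P \<in> on_line A l \<longleftrightarrow> (\<exists>i\<in>{0..4}. \<exists>z\<in>T i. P = pt z (Y i) (X i) \<and> pt z (Y i) (X i) \<subseteq> l)"
  unfolding on_line_def A_def mem_Collect_eq UN_iff mem_S by blast

lemma on_line_pencil_line:
  assumes "y \<noteq> 0 \<or> x \<noteq> 0"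
  shows "on_line A (pencil_line y x) = (\<Union>i\<in>{i \<in> {0..4}. x * Y i = y * X i}. S i)"
  by (rule set_eqI) (auto simp: mem_on_line mem_S pt_subset_pencil_line[OF assms])

lemma on_line_secant:
  assumes i: "i \<in> {0..4}"
  shows "on_line A (secant i) = S i"
proof -
  have "{j \<in> {0..4}. X i * Y j = Y i * X j} = {i}"
    using Y_X_distinct[OF _ i] i by (auto simp: mult.commute)
  then show ?thesis
    using Y_X_nonzero[OF i] by (simp only: secant_def on_line_pencil_line) simp
qed

lemma card_on_line_pencil_line:
  assumes "y \<noteq> 0 \<or> x \<noteq> 0"
  shows "card (on_line A (pencil_line y x)) \<in> {0, CARD('a) div 4}"
proof (cases "\<exists>i\<in>{0..4}. x * Y i = y * X i")
  case True
  then obtain i where i: "i \<in> {0..4}" "x * Y i = y * X i"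
    by blast
  have "j = i" if j: "j \<in> {0..4}" "x * Y j = y * X j" for j
  proof -
    \<comment> \<open>The wanted equation is obtained multiplied by \<open>x\<close> and multiplied
      by \<open>y\<close>; at least one of these factors is nonzero and cancels.\<close>
    have "x * (X i * Y j) = x * (Y i * X j)" "y * (X i * Y j) = y * (Y i * X j)"
      using i(2) j(2) by algebra+
    then have "X i * Y j = Y i * X j"
      using assms by auto
    then show ?thesis
      using Y_X_distinct[OF j(1) i(1)] by simp
  qed
  then have "{i \<in> {0..4}. x * Y i = y * X i} = {i}"
    using i by blast
  then show ?thesis
    using i by (simp add: on_line_pencil_line[OF assms] card_S del: atLeastAtMost_iff)
next
  case False
  then have "{i \<in> {0..4}. x * Y i = y * X i} = {}"
    by blast
  then show ?thesis
    by (simp only: on_line_pencil_line[OF assms]) simp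
qed

lemma card_on_line_transversal:
  "card (on_line A (transversal u w)) = card {i \<in> {0..4}. u * Y i + w * X i \<in> T i}"
proof -
  have "on_line A (transversal u w) =
      (\<lambda>i. pt (u * Y i + w * X i) (Y i) (X i)) ` {i \<in> {0..4}. u * Y i + w * X i \<in> T i}"
    by (rule set_eqI) (auto simp: mem_on_line pt_subset_transversal)
  moreover have "inj_on (\<lambda>i. pt (u * Y i + w * X i) (Y i) (X i)) {i \<in> {0..4}. u * Y i + w * X i \<in> T i}"
    by (auto intro!: inj_onI dest: pt_eq_imp_index_eq[rotated 2])
  ultimately show ?thesis
    by (simp add: card_image)
qed

lemma card_on_line_transversal_in: "card (on_line A (transversal u w)) \<in> {0, 2}"
proof -
  have "{i \<in> {0..4}. u * Y i + w * X i \<in> T i} =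
      {i \<in> {0..4}. meets i (tr u) (tr (u * cp)) (tr (u * ck)) (tr w) (tr (w * cg)) (tr (w * ck))}"
    using mem_T_iff_meets by blast
  then show ?thesis
    by (simp only: card_on_line_transversal card_meets)
qed

text \<open>For \<open>u\<close> off \<open>S\<^sub>0\<close>, the lines \<open>X = uY + wZ\<close> that meet \<open>S\<^sub>1 \<union> S\<^sub>2 \<union> S\<^sub>3\<close> are at most \<open>3q/4\<close> in
  number, so some \<open>w\<close> gives a line that meets the arc in at most one point, hence in none.\<close>

lemma exists_external_line: "\<exists>l\<in>pg_lines. card (on_line A l) = 0"
proof -
  have q: "0 < CARD('a)"
    by simp
  have "4 * card (T 0) = CARD('a)"
    by (rule card_T) simp
  then have "card (T 0) < CARD('a)"
    using q by linarith
  then obtain u where u: "u \<notin> T 0"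
    by (metis UNIV_eq_I less_irrefl)
  let ?B = "\<lambda>i. {w. u * Y i + w \<in> T i}"
  have card_B: "4 * card (?B i) = CARD('a)" if "i \<in> {0..4}" for i
  proof -
    have "bij_betw (\<lambda>w. u * Y i + w) (?B i) (T i)"
      by (rule bij_betw_byWitness[where f' = "\<lambda>z. u * Y i + z"]) (auto simp: add_cancel)
    then have "card (?B i) = card (T i)"
      by (rule bij_betw_same_card)
    then show ?thesis
      using card_T[OF that] by simp
  qed
  have "card (?B 1 \<union> ?B 2 \<union> ?B 3) \<le> card (?B 1) + card (?B 2) + card (?B 3)"
    using card_Un_le[of "?B 1 \<union> ?B 2" "?B 3"] card_Un_le[of "?B 1" "?B 2"] by linarith
  moreover have "4 * card (?B 1) = CARD('a)" "4 * card (?B 2) = CARD('a)" "4 * card (?B 3) = CARD('a)"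
    by (rule card_B; simp)+
  ultimately have "card (?B 1 \<union> ?B 2 \<union> ?B 3) < CARD('a)"
    using q by linarith
  then obtain w where "w \<notin> ?B 1 \<union> ?B 2 \<union> ?B 3"
    by (metis UNIV_eq_I less_irrefl)
  then have "{i \<in> {0..4}. u * Y i + w * X i \<in> T i} \<subseteq> {4}"
    using u unfolding atLeastAtMost_0_4 by (auto simp: X_def Y_def)
  then have "card (on_line A (transversal u w)) \<le> card {4::nat}"
    unfolding card_on_line_transversal by (rule card_mono[rotated]) simp
  then have "card (on_line A (transversal u w)) = 0"
    using card_on_line_transversal_in[of u w] by auto
  then show ?thesis
    using transversal_in_pg_lines by blast
qed

text \<open>A transversal with \<open>u\<close> in \<open>T 0\<close> meets \<open>S 0\<close>, so
  its number of points, known to be 0 or 2, is 2.\<close>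

lemma exists_bisecant: "\<exists>l\<in>pg_lines. card (on_line A l) = 2"
proof -
  have "T i \<noteq> {}" if "i \<in> {0..4}" for i
    using card_T[OF that] by auto
  from this[of 0] this[of 1] obtain u w where "u \<in> T 0" "w \<in> T 1"
    by auto
  then have "0 \<in> {i \<in> {0..4}. u * Y i + w * X i \<in> T i}"
    by (simp add: X_def Y_def)
  then have "card (on_line A (transversal u w)) \<noteq> 0"
    unfolding card_on_line_transversal by (subst card_0_eq) auto
  then show ?thesis
    using card_on_line_transversal_in[of u w] transversal_in_pg_lines by auto
qed

lemma KM_arc_A: "KM_arc (CARD('a) div 4) A"
  unfolding KM_arc_def
proof (intro conjI ballI)
  show "A \<subseteq> pg_points"
    using Y_X_nonzero by (fastforce simp: A_def mem_S intro: pt_in_pg_points)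
  show "card A = CARD('a) + CARD('a) div 4"
    by (rule card_A)
  show "card (on_line A l) \<in> {0, 2, CARD('a) div 4}" if "l \<in> pg_lines" for l
    using that
  proof (cases rule: pg_lines_cases)
    case (pencil y x)
    then show ?thesis
      using card_on_line_pencil_line[of y x] by auto
  next
    case (transversal u w)
    then show ?thesis
      using card_on_line_transversal_in[of u w] by auto
  qed
  have "\<exists>l\<in>pg_lines. card (on_line A l) = CARD('a) div 4"
    using secant_in_pg_lines[of 0] card_S[of 0] on_line_secant[of 0] by (intro bexI[of _ "secant 0"]) simp_all
  then show "\<exists>l\<in>pg_lines. card (on_line A l) = m" if "m \<in> {0, 2, CARD('a) div 4}" for m
    using that exists_external_line exists_bisecant by blast
qed

lemma secant_0: "secant 0 = line_Z0"
  by (auto simp: secant_def pencil_line_def line_Z0_def X_def Y_def)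

lemma KM_quarter_A: "KM_quarter A (pt 1 0 0) secant"
  unfolding KM_quarter_def
proof (intro conjI ballI KM_arc_A)
  show "pt 1 0 0 \<in> pg_points"
    by (rule pt_in_pg_points) simp
  show "pt 1 0 0 \<notin> A"
    using Y_X_nonzero by (fastforce simp: A_def mem_S elim: pt_eqD)
  show "inj_on secant {0..4}"
  proof (rule inj_onI)
    fix i j :: nat
    assume i: "i \<in> {0..4}" and j: "j \<in> {0..4}" and eq: "secant i = secant j"
    \<comment> \<open>This point of the secant differs from (1,0,0), so it identifies the secant
      within the pencil.\<close>
    have "pt 0 (Y i) (X i) \<subseteq> secant i"
      using Y_X_nonzero[OF i] by (simp add: secant_def pt_subset_pencil_line mult.commute)
    then have "pt 0 (Y i) (X i) \<subseteq> secant j"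
      by (simp only: eq)
    then show "i = j"
      using Y_X_nonzero[OF j] Y_X_distinct[OF i j] by (simp add: secant_def pt_subset_pencil_line)
  qed
  fix i :: nat assume i: "i \<in> {0..4}"
  show "secant i \<in> pg_lines" "pt 1 0 0 \<subseteq> secant i" "card (on_line A (secant i)) = CARD('a) div 4"
    using i Y_X_nonzero[OF i] secant_in_pg_lines on_line_secant card_S
    by (simp_all add: secant_def pt_subset_pencil_line)
qed

lemma is_club_S:
  assumes "3 \<le> h" "i \<in> {0..4}"
  shows "is_club (h - 2) (h - 1) (secant i) (pt 1 0 0) (insert (pt 1 0 0) (on_line A (secant i)))"
  unfolding on_line_secant[OF assms(2)] unfolding secant_def S_def T_def
  using is_club_codim_2 M_M'[OF assms(2)] Y_X_nonzero[OF assms(2)] assms(1) by simp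

section \<open>The sets \<open>Dset\<close> in affine coordinates\<close>

text \<open>The line X = \<open>u\<close>Y + \<open>w\<close>Z meets Z = 0 in (\<open>u\<close>,1,0)
  whatever \<open>w\<close> is. For \<open>i\<close>, \<open>j\<close> between 1 and 4, where
  \<open>X\<close> is 1, this is therefore the set of parameters on Z = 0 of the joins of
  \<open>S i\<close> and \<open>S j\<close>.\<close>

definition E :: "nat \<Rightarrow> nat \<Rightarrow> 'a set" where
  "E i j = {u. \<exists>w. u * Y i + w \<in> T i \<and> u * Y j + w \<in> T j}"

text \<open>Points with first coordinates \<open>z\<close> and \<open>z'\<close> are joined by the
  transversal with \<open>u = (z - z') / (Y i - Y j)\<close> and
  \<open>w = z - u * Y i\<close>.\<close>

lemma Dset_eq:
  assumes i: "i \<in> {1..4}" and j: "j \<in> {1..4}" and "i \<noteq> j"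
  shows "Dset A secant i j = (\<lambda>u. pt u 1 0) ` E i j"
proof -
  have "i \<in> {0..4}" "j \<in> {0..4}" and X: "X i = 1" "X j = 1"
    using i j X_1 by auto
  then have neq: "Y i \<noteq> Y j" and on: "on_line A (secant i) = S i" "on_line A (secant j) = S j"
    using \<open>i \<noteq> j\<close> Y_X_distinct[of i j] on_line_secant by auto
  have "Dset A secant i j = {pt ((z - z') / (Y i - Y j)) 1 0 | z z'. z \<in> T i \<and> z' \<in> T j}"
    unfolding Dset_def on secant_0 using join_meet_line_Z0[OF neq] by (fastforce simp: mem_S X)
  also have "\<dots> = (\<lambda>u. pt u 1 0) ` {(z - z') / (Y i - Y j) | z z'. z \<in> T i \<and> z' \<in> T j}"
    by blast
  also have "{(z - z') / (Y i - Y j) | z z'. z \<in> T i \<and> z' \<in> T j} = E i j"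
  proof (intro equalityI subsetI)
    fix u assume "u \<in> {(z - z') / (Y i - Y j) | z z'. z \<in> T i \<and> z' \<in> T j}"
    then obtain z z' where z: "z \<in> T i" "z' \<in> T j" and "u = (z - z') / (Y i - Y j)"
      by blast
    then have "u * (Y i - Y j) = z - z'"
      using neq by simp
    then have "u * Y j + (z - u * Y i) = z'"
      by (simp add: algebra_simps)
    then show "u \<in> E i j"
      unfolding E_def using z by (intro CollectI exI[of _ "z - u * Y i"]) simp
  next
    fix u assume "u \<in> E i j"
    then obtain w where "u * Y i + w \<in> T i" "u * Y j + w \<in> T j"
      by (auto simp: E_def)
    moreover have "u = ((u * Y i + w) - (u * Y j + w)) / (Y i - Y j)"
      using neq by (simp flip: right_diff_distrib)
    ultimately show "u \<in> {(z - z') / (Y i - Y j) | z z'. z \<in> T i \<and> z' \<in> T j}"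
      by blast
  qed
  finally show ?thesis .
qed

lemma E_eq:
  assumes "i \<in> {1..4}" "j \<in> {1..4}"
  shows "E i j = {u. \<exists>w. meets i (tr u) (tr (u * cp)) (tr (u * ck)) (tr w) (tr (w * cg)) (tr (w * ck)) \<and>
    meets j (tr u) (tr (u * cp)) (tr (u * ck)) (tr w) (tr (w * cg)) (tr (w * ck))}"
proof -
  have "i \<in> {0..4}" "j \<in> {0..4}" "X i = 1" "X j = 1"
    using assms X_1 by auto
  then show ?thesis
    unfolding E_def using mem_T_iff_meets[of i] mem_T_iff_meets[of j] by simp
qed

text \<open>The elements 1, \<open>cg\<close>, \<open>ck\<close> are independent, their sum being
  \<open>cx\<close>, so the quantifier over \<open>w\<close> becomes one over three free bits.
  Eliminating these leaves one condition on \<open>u\<close>.\<close>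

lemma E_generic:
  assumes "ck \<noteq> cg"
  shows "E 1 2 = {u. tr (u * 1) = 1}" "E 3 4 = {u. tr (u * 1) = 1}"
    "E 1 3 = {u. tr (u * cp) = a + 1}" "E 2 4 = {u. tr (u * cp) = a + 1}"
    "E 1 4 = {u. tr (u * (1 + cp)) = a + 1}" "E 2 3 = {u. tr (u * (1 + cp)) = a + 1}"
proof -
  have "\<exists>w. tr (w * 1) = c \<and> tr (w * cg) = d \<and> tr (w * ck) = e" for c d e
    using nonzero distinct_coeffs assms relations(5) by (intro functionals_surj_3) auto
  then have ex: "(\<exists>w. Q (tr w) (tr (w * cg)) (tr (w * ck))) \<longleftrightarrow> (\<exists>c d e. Q c d e)" for Q
    by (metis mult_1_right)
  have E: "E i j = {u. \<exists>c d e. meets i (tr u) (tr (u * cp)) (tr (u * ck)) c d e \<and>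
      meets j (tr u) (tr (u * cp)) (tr (u * ck)) c d e}" if "i \<in> {1..4}" "j \<in> {1..4}" for i j
    unfolding E_eq[OF that]
    by (intro Collect_cong ex[of "\<lambda>c d e. meets i (tr _) (tr (_ * cp)) (tr (_ * ck)) c d e \<and>
        meets j (tr _) (tr (_ * cp)) (tr (_ * ck)) c d e"])
  have "(\<exists>c d e. meets 1 s t v c d e \<and> meets 2 s t v c d e) \<longleftrightarrow> s = 1"
    "(\<exists>c d e. meets 3 s t v c d e \<and> meets 4 s t v c d e) \<longleftrightarrow> s = 1"
    "(\<exists>c d e. meets 1 s t v c d e \<and> meets 3 s t v c d e) \<longleftrightarrow> t = a + 1"
    "(\<exists>c d e. meets 2 s t v c d e \<and> meets 4 s t v c d e) \<longleftrightarrow> t = a + 1"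
    "(\<exists>c d e. meets 1 s t v c d e \<and> meets 4 s t v c d e) \<longleftrightarrow> s + t = a + 1"
    "(\<exists>c d e. meets 2 s t v c d e \<and> meets 3 s t v c d e) \<longleftrightarrow> s + t = a + 1" for s t v
    unfolding meets_def ex_bit by (cases s; cases t; cases v; cases a; cases b; simp)+
  then show "E 1 2 = {u. tr (u * 1) = 1}" "E 3 4 = {u. tr (u * 1) = 1}"
    "E 1 3 = {u. tr (u * cp) = a + 1}" "E 2 4 = {u. tr (u * cp) = a + 1}"
    "E 1 4 = {u. tr (u * (1 + cp)) = a + 1}" "E 2 3 = {u. tr (u * (1 + cp)) = a + 1}"
    by (simp_all add: E distrib_left tr_add)
qed

text \<open>The last two traces of \<open>w\<close> now coincide, hence the repeated argument
  \<open>d\<close>. With only two free bits to eliminate, a second condition on \<open>u\<close>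
  survives.\<close>

lemma E_special:
  assumes "ck = cg"
  shows "E 1 2 = {u. tr (u * 1) = 1 \<and> tr (u * ck) = b}" "E 3 4 = {u. tr (u * 1) = 1 \<and> tr (u * ck) = b}"
    "E 1 3 = {u. tr (u * cp) = a + 1 \<and> tr (u * ck) = b + 1}"
    "E 2 4 = {u. tr (u * cp) = a + 1 \<and> tr (u * ck) = b + 1}"
    "E 1 4 = {u. tr (u * (1 + ck)) = b \<and> tr (u * (cp + ck)) = a + b + 1}"
    "E 2 3 = {u. tr (u * (1 + ck)) = b \<and> tr (u * (cp + ck)) = a + b + 1}"
proof -
  have "\<exists>w. tr (w * 1) = c \<and> tr (w * cg) = d" for c d
    using nonzero distinct_coeffs by (intro functionals_surj_2) auto
  then have ex: "(\<exists>w. Q (tr w) (tr (w * cg))) \<longleftrightarrow> (\<exists>c d. Q c d)" for Q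
    by (metis mult_1_right)
  have E: "E i j = {u. \<exists>c d. meets i (tr u) (tr (u * cp)) (tr (u * ck)) c d d \<and>
      meets j (tr u) (tr (u * cp)) (tr (u * ck)) c d d}" if "i \<in> {1..4}" "j \<in> {1..4}" for i j
    unfolding E_eq[OF that] assms
    by (intro Collect_cong ex[of "\<lambda>c d. meets i (tr _) (tr (_ * cp)) (tr (_ * cg)) c d d \<and>
        meets j (tr _) (tr (_ * cp)) (tr (_ * cg)) c d d"])
  have "(\<exists>c d. meets 1 s t v c d d \<and> meets 2 s t v c d d) \<longleftrightarrow> s = 1 \<and> v = b"
    "(\<exists>c d. meets 3 s t v c d d \<and> meets 4 s t v c d d) \<longleftrightarrow> s = 1 \<and> v = b"
    "(\<exists>c d. meets 1 s t v c d d \<and> meets 3 s t v c d d) \<longleftrightarrow> t = a + 1 \<and> v = b + 1"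
    "(\<exists>c d. meets 2 s t v c d d \<and> meets 4 s t v c d d) \<longleftrightarrow> t = a + 1 \<and> v = b + 1"
    "(\<exists>c d. meets 1 s t v c d d \<and> meets 4 s t v c d d) \<longleftrightarrow> s + v = b \<and> t + v = a + b + 1"
    "(\<exists>c d. meets 2 s t v c d d \<and> meets 3 s t v c d d) \<longleftrightarrow> s + v = b \<and> t + v = a + b + 1" for s t v
    unfolding meets_def ex_bit by (cases s; cases t; cases v; cases a; cases b; simp)+
  then show "E 1 2 = {u. tr (u * 1) = 1 \<and> tr (u * ck) = b}" "E 3 4 = {u. tr (u * 1) = 1 \<and> tr (u * ck) = b}"
    "E 1 3 = {u. tr (u * cp) = a + 1 \<and> tr (u * ck) = b + 1}"
    "E 2 4 = {u. tr (u * cp) = a + 1 \<and> tr (u * ck) = b + 1}"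
    "E 1 4 = {u. tr (u * (1 + ck)) = b \<and> tr (u * (cp + ck)) = a + b + 1}"
    "E 2 3 = {u. tr (u * (1 + ck)) = b \<and> tr (u * (cp + ck)) = a + b + 1}"
    by (simp_all add: E distrib_left tr_add)
qed

section \<open>Verification of the two properties\<close>

lemma inj_pt_1_0: "inj (\<lambda>u::'a. pt u 1 0)"
  by (simp add: inj_def pt_inj)

lemma common_12_A:
  assumes "3 \<le> h"
  shows "common_12 h A (pt 1 0 0) secant"
proof -
  have "E 1 2 = E 3 4 \<and> E 1 3 = E 2 4 \<and> E 1 4 = E 2 3"
    using E_generic E_special by (cases "ck = cg") simp_all
  then show ?thesis
    unfolding common_12_def using is_club_S[OF assms] by (fastforce simp: Dset_eq)
qed

lemma property_I_A:
  assumes h: "3 \<le> h" and "ck = cg"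
  shows "property_I h A line_Z0"
proof -
  note E = E_special[OF \<open>ck = cg\<close>]
  have "1 + ck \<noteq> 0" "cp + ck \<noteq> 0" "1 + ck \<noteq> cp + ck"
    using distinct_coeffs by (simp_all add: add_eq_0_iff_eq)
  then have club: "is_club (h - 2) (h - 1) line_Z0 (pt 1 0 0) (insert (pt 1 0 0) ((\<lambda>u. pt u 1 0) ` E 1 j))"
    if "j \<in> {2, 3, 4}" for j
    using that E nonzero distinct_coeffs h is_club_codim_2[of 1 ck 1 0] is_club_codim_2[of cp ck 1 0]
      is_club_codim_2[of "1 + ck" "cp + ck" 1 0]
    by (auto simp: secant_def X_def Y_def simp flip: secant_0)
  \<comment> \<open>Adding the two conditions of \<open>E 1 2\<close> gives \<open>b + 1\<close>
    where \<open>E 1 4\<close> demands \<open>b\<close>; adding those of \<open>E 1 3\<close> gives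
    \<open>a + b\<close> where \<open>E 1 4\<close> demands \<open>a + b + 1\<close>.\<close>
  have "tr (u * 1) = 1 \<and> tr (u * ck) = b \<Longrightarrow> tr (u * (1 + ck)) \<noteq> b"
    "tr (u * cp) = a + 1 \<and> tr (u * ck) = b + 1 \<Longrightarrow> tr (u * (cp + ck)) \<noteq> a + b + 1" for u
    by (cases a; cases b; simp add: distrib_left tr_add)+
  then have "E 1 2 \<inter> E 1 3 = {}" "E 1 2 \<inter> E 1 4 = {}" "E 1 3 \<inter> E 1 4 = {}"
    unfolding E by auto
  moreover have "{2..4::nat} = {2, 3, 4}"
    by auto
  ultimately show ?thesis
    unfolding property_I_def
    using KM_quarter_A common_12_A[OF h] club
    by (intro exI[of _ "pt 1 0 0"] exI[of _ secant]) (simp add: secant_0 Dset_eq image_Int[OF inj_pt_1_0, symmetric])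
qed

lemma property_II_A:
  assumes h: "3 \<le> h" and "ck \<noteq> cg"
  shows "property_II h A line_Z0"
proof -
  note E = E_generic[OF \<open>ck \<noteq> cg\<close>]
  have nz: "1 + cp \<noteq> 0" "1 \<noteq> 1 + cp" "cp \<noteq> 1 + cp"
    using distinct_coeffs nonzero by (simp_all add: add_eq_0_iff_eq)
  then have club: "is_club (h - 1) h line_Z0 (pt 1 0 0) (insert (pt 1 0 0) ((\<lambda>u. pt u 1 0) ` E 1 j))"
    if "j \<in> {2, 3, 4}" for j
    using that E nz nonzero h is_club_hyperplane[of 1 1 0] is_club_hyperplane[of cp 1 0]
      is_club_hyperplane[of "1 + cp" 1 0]
    by (auto simp: secant_def X_def Y_def simp flip: secant_0)
  have card: "card ((\<lambda>u::'a. pt u 1 0) ` C) = card C" for C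
    using inj_pt_1_0 by (simp add: card_image inj_on_def inj_def)
  \<comment> \<open>Any two of the multipliers 1, \<open>cp\<close>, \<open>1 + cp\<close> are
    distinct and nonzero, so two of the hyperplanes meet in codimension two.\<close>
  have "4 * card (E 1 2 \<inter> E 1 3) = CARD('a)" "4 * card (E 1 2 \<inter> E 1 4) = CARD('a)" "4 * card (E 1 3 \<inter> E 1 4) = CARD('a)"
    unfolding E Collect_conj_eq[symmetric]
    using nz nonzero distinct_coeffs by (intro card_codim_2; simp)+
  then have cards: "card (E 1 2 \<inter> E 1 3) = CARD('a) div 4" "card (E 1 2 \<inter> E 1 4) = CARD('a) div 4"
    "card (E 1 3 \<inter> E 1 4) = CARD('a) div 4"
    by linarith+
  \<comment> \<open>The three multipliers add up to 0, while the three prescribed values add up to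
    1.\<close>
  have "tr (u * 1) = 1 \<and> tr (u * cp) = a + 1 \<Longrightarrow> tr (u * (1 + cp)) \<noteq> a + 1" for u
    by (cases a; simp add: distrib_left tr_add)
  then have "E 1 2 \<inter> E 1 3 \<inter> E 1 4 = {}"
    unfolding E by auto
  moreover have "{2..4::nat} = {2, 3, 4}"
    by auto
  ultimately show ?thesis
    unfolding property_II_def
    using KM_quarter_A common_12_A[OF h] club cards
    by (intro exI[of _ "pt 1 0 0"] exI[of _ secant])
      (simp add: secant_0 Dset_eq card image_Int[OF inj_pt_1_0, symmetric])
qed

end

section \<open>Return to the absolute trace\<close>

text \<open>The guard \<open>3 \<le> h\<close> excludes the field of order 4, where item (1) would
  ask for a head of weight 0, although every point of a linear set has weight at least 1.\<close>

theorem theorem4p6: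
  fixes h :: nat
    and \<alpha> \<beta> \<gamma> \<xi> :: "'a::{field,finite}"
    and a b :: bit
    and Tr :: "'a \<Rightarrow> 'a"
    and S0 S1 S2 S3 S4 A :: "'a subsp set"
  assumes q: "CARD('a) = 2 ^ h"
    and Tr: "Tr = abs_trace h"
    and \<alpha>: "\<alpha> \<notin> {0, 1}" and \<beta>: "\<beta> \<notin> {0, 1}" and \<alpha>\<beta>: "\<alpha> * \<beta> \<noteq> 1"
    and \<gamma>: "\<gamma> = (\<beta> + 1) / (\<alpha> * \<beta> + 1)"
    and \<xi>: "\<xi> = \<alpha> * \<beta> * \<gamma>"
    and S0: "S0 = {pt z 1 0 | z. Tr z = 0 \<and> Tr (z / \<alpha>) = of_F2 a}"
    and S1: "S1 = {pt z 0 1 | z. Tr z = 0 \<and> Tr (z / (\<alpha> * \<gamma>)) = 0}"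
    and S2: "S2 = {pt z 1 1 | z. Tr z = 1 \<and> Tr (z / (\<alpha> * \<beta>)) = of_F2 b}"
    and S3: "S3 = {pt z \<gamma> 1 | z. Tr (z / (\<alpha> * \<gamma>)) = of_F2 (a + 1) \<and> Tr (z / \<xi>) = of_F2 (b + 1)}"
    and S4: "S4 = {pt z (\<beta> + 1) 1 | z. Tr (z / (\<alpha> * \<beta>)) = of_F2 (a + b + 1) \<and> Tr (z / \<xi>) = of_F2 b}"
    and A: "A = S0 \<union> S1 \<union> S2 \<union> S3 \<union> S4"
  shows "KM_arc (CARD('a) div 4) A \<and>
    (3 \<le> h \<longrightarrow> property_I h A line_Z0 \<or> property_II h A line_Z0)"
proof -
  obtain tr :: "'a \<Rightarrow> bit" where "even_field_functional h tr" and "\<And>z. abs_trace h z = of_F2 (tr z)"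
    using abs_trace_functional[OF q] by blast
  then interpret K: km_construction h tr \<alpha> \<beta> \<gamma> \<xi> a b
    using \<alpha> \<beta> \<alpha>\<beta> \<gamma> \<xi> by (simp add: km_construction_def km_construction_axioms_def)
  have Tr_tr: "Tr z = of_F2 (tr z)" "Tr z = 0 \<longleftrightarrow> tr z = 0" "Tr z = 1 \<longleftrightarrow> tr z = 1" for z
    using \<open>\<And>z. abs_trace h z = of_F2 (tr z)\<close> by (auto simp: Tr of_F2_def)
  note defs = K.S_def K.T_def K.X_def K.Y_def K.M_def K.M'_def K.r_def K.r'_def
    K.cp_def K.cg_def K.ck_def K.cx_def
  have "S0 = K.S 0" "S1 = K.S 1" "S2 = K.S 2" "S3 = K.S 3" "S4 = K.S 4"
    unfolding S0 S1 S2 S3 S4 Tr_tr(2,3) unfolding Tr_tr(1) inj_of_F2 by (auto simp: defs)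
  then have "A = K.A"
    unfolding A K.A_def atLeastAtMost_0_4 by auto
  then show ?thesis
    using K.KM_arc_A K.property_I_A K.property_II_A by blast
qed

end
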